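(* Let $(X,(\|\cdot\|_q)_{q\ge 1})$ be a Fréchet sequence algebra under the Cauchy product in which $(e_n)_{n\ge 0}$ is a basis with Property B, and let $B_w$ be a mixing weighted backward shift on $X$. Then $HC(B_w)$ contains an algebra, except zero, that is not finitely generated; that is, there is a subalgebra $\mathcal{A}$ of $X$ that is not finitely generated and satisfies $\mathcal{A}\setminus\{0\}\subset HC(B_w)$. In other words, $HC(B_w)$ is algebrable.
   Context: $\omega$ is the space of all complex sequences $x=(x_n)_{n\ge 0}$ with the topology of coordinatewise convergence; $e_n\in\omega$ is the sequence with $1$ at index $n$ and $0$ elsewhere. The Cauchy product of $x,y\in\omega$ is $x\ast y=(z_n)_n$ with $z_n=\sum_{k=0}^n x_ky_{n-k}$. A Fréchet algebra is a complex algebra $X$ that is a (locally convex) Fréchet space whose topology is induced by an increasing sequence $(\|\cdot\|_q)_{q\ge1}$ of seminorms that are submultiplicative for the product, i.e. $\|x\ast y\|_q\le\|x\|_q\|y\|_q$ for all $x,y\in X$, $q\ge1$. A Fréchet sequence algebra under the Cauchy product is a subalgebra $X$ of $(\omega,\ast)$ that carries a Fréchet algebra structure such that the embedding $X\hookrightarrow\omega$ is continuous. "Basis" means Schauder basis. Property B of $(e_n)_n$: $X$ contains all $e_n$ and (i) there is some $q\ge1$ such that $\|e_n\|_q>0$ for all $n\ge0$; (ii) for any $r\ge1$ there are $q\ge1$ and $C_1>0$ such that $\|e_n\|_r\cdot\|e_k\|_r\le C_1\|e_{n+k}\|_q$ for all $n,k\ge0$; (iii) for any $m\ge2$, $M\ge1$,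 $r\ge1$ there is some $\rho\ge1$ such that for any $t\ge1$ there are $\tau\ge1$ and $C_2>0$ such that, for any $0\le k\le M$ and $n\ge M$, $\|e_{mn}\|_t\cdot\|e_{n-k}\|_r\le C_2\|e_{mn}\|_\tau^{1/m}\cdot\|e_{mn-k}\|_\rho$. A weight is a sequence $w=(w_n)_{n\ge0}$ of non-zero complex numbers, with the convention $w_0=1$. The weighted backward shift is $B_w(x_0,x_1,x_2,\dots)=(w_1x_1,w_2x_2,w_3x_3,\dots)$; saying that it is a weighted backward shift on $X$ means that it maps $X$ into $X$ (it is then a continuous linear operator on $X$). An operator $T$ on $X$ is mixing if for any non-empty open $U,V\subset X$ the set $\{n\ge0:T^n(U)\cap V\ne\varnothing\}$ is co-finite. $HC(T)=\{x\in X:\{x,Tx,T^2x,\dots\}\text{ is dense in }X\}$. Algebras are not required to be unital; the algebra generated by a set is the smallest subalgebra containing it (the linear span of all finite products of at least one element of the set). An algebra is finitely generated if it is generated by a finite subset. $HC(T)$ is algebrable if $HC(T)\cup\{0\}$ contains a subalgebra of $X$ that is infinitely but not finitely generated. *)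

theory Defs
  imports "HOL-Analysis.Analysis" "HOL-Library.Function_Algebras"
begin

text \<open>Sums, differences and zero of sequences are the pointwise ones of
  \<open>HOL-Library.Function_Algebras\<close>. The pointwise product \<open>*\<close> of that theory is \<^emph>\<open>not\<close> the
  product of the algebras considered here, which is \<open>cauchy_prod\<close>. The space \<open>\<omega>\<close> is the
  type \<open>cseq\<close>, whose class topology (\<open>Function_Topology\<close>) is that of coordinatewise convergence.\<close>

type_synonym cseq = "nat \<Rightarrow> complex"

definition scale_seq :: "complex \<Rightarrow> cseq \<Rightarrow> cseq" where
  "scale_seq c x = (\<lambda>n. c * x n)"

interpretation seq: vector_space scale_seq
  by standard (auto simp: scale_seq_def algebra_simps)

definition unit_seq :: "nat \<Rightarrow> cseq" where
  "unit_seq n = (\<lambda>i. if i = n then 1 else 0)"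

definition cauchy_prod :: "cseq \<Rightarrow> cseq \<Rightarrow> cseq" where
  "cauchy_prod x y = (\<lambda>n. \<Sum>k\<le>n. x k * y (n - k))"


subsection \<open>Subalgebras of \<open>\<omega>\<close> (not necessarily unital)\<close>

definition subalgebra_seq :: "cseq set \<Rightarrow> bool" where
  "subalgebra_seq A \<longleftrightarrow> seq.subspace A \<and> (\<forall>x\<in>A. \<forall>y\<in>A. cauchy_prod x y \<in> A)"

text \<open>\<open>subalgebra_seq hull S\<close> is the smallest subalgebra containing \<open>S\<close>; if \<open>S\<close> lies in a
  subalgebra \<open>X\<close>, then it does not matter whether this is formed in \<open>X\<close> or in \<open>\<omega>\<close>.\<close>

definition finitely_generated_alg :: "cseq set \<Rightarrow> bool" where
  "finitely_generated_alg A \<longleftrightarrow> (\<exists>S. finite S \<and> subalgebra_seq hull S = A)"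

definition infinitely_generated_alg :: "cseq set \<Rightarrow> bool" where
  "infinitely_generated_alg A \<longleftrightarrow> (\<exists>S. infinite S \<and> subalgebra_seq hull S = A)"


subsection \<open>Frechet sequence algebras\<close>

text \<open>Seminorms are functions on all of \<open>\<omega>\<close> of which only the values on \<open>X\<close> matter, and in a
  sequence \<open>p\<close> of seminorms only the indices \<open>q \<ge> 1\<close> are used.\<close>

definition seminorm_on :: "cseq set \<Rightarrow> (cseq \<Rightarrow> real) \<Rightarrow> bool" where
  "seminorm_on X N \<longleftrightarrow>
     (\<forall>x\<in>X. 0 \<le> N x) \<and>
     (\<forall>x\<in>X. \<forall>y\<in>X. N (x + y) \<le> N x + N y) \<and>
     (\<forall>c. \<forall>x\<in>X. N (scale_seq c x) = cmod c * N x)"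

definition seminorm_topology :: "cseq set \<Rightarrow> (nat \<Rightarrow> cseq \<Rightarrow> real) \<Rightarrow> cseq topology" where
  "seminorm_topology X p =
     topology_generated_by {{y \<in> X. p q (y - x) < \<epsilon>} | x q \<epsilon>. x \<in> X \<and> 1 \<le> q \<and> 0 < \<epsilon>}"

definition seminorm_Cauchy :: "(nat \<Rightarrow> cseq \<Rightarrow> real) \<Rightarrow> (nat \<Rightarrow> cseq) \<Rightarrow> bool" where
  "seminorm_Cauchy p s \<longleftrightarrow>
     (\<forall>q\<ge>1. \<forall>\<epsilon>>0. \<exists>N. \<forall>i\<ge>N. \<forall>j\<ge>N. p q (s i - s j) < \<epsilon>)"

definition frechet_space :: "cseq set \<Rightarrow> (nat \<Rightarrow> cseq \<Rightarrow> real) \<Rightarrow> bool" where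
  "frechet_space X p \<longleftrightarrow>
     seq.subspace X \<and>
     (\<forall>q\<ge>1. seminorm_on X (p q)) \<and>
     (\<forall>q\<ge>1. \<forall>r\<ge>q. \<forall>x\<in>X. p q x \<le> p r x) \<and>
     Hausdorff_space (seminorm_topology X p) \<and>
     (\<forall>s. range s \<subseteq> X \<and> seminorm_Cauchy p s \<longrightarrow>
        (\<exists>l. limitin (seminorm_topology X p) s l sequentially))"

definition frechet_sequence_algebra :: "cseq set \<Rightarrow> (nat \<Rightarrow> cseq \<Rightarrow> real) \<Rightarrow> bool" where
  "frechet_sequence_algebra X p \<longleftrightarrow>
     subalgebra_seq X \<and>
     frechet_space X p \<and>
     (\<forall>q\<ge>1. \<forall>x\<in>X. \<forall>y\<in>X. p q (cauchy_prod x y) \<le> p q x * p q y) \<and>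
     continuous_map (seminorm_topology X p) euclidean (\<lambda>x. x)"

definition schauder_basis :: "cseq topology \<Rightarrow> (nat \<Rightarrow> cseq) \<Rightarrow> bool" where
  "schauder_basis T b \<longleftrightarrow>
     range b \<subseteq> topspace T \<and>
     (\<forall>x\<in>topspace T. \<exists>!a::nat \<Rightarrow> complex.
        limitin T (\<lambda>N. \<Sum>n<N. scale_seq (a n) (b n)) x sequentially)"

definition property_B :: "cseq set \<Rightarrow> (nat \<Rightarrow> cseq \<Rightarrow> real) \<Rightarrow> bool" where
  "property_B X p \<longleftrightarrow>
     (\<forall>n. unit_seq n \<in> X) \<and>
     (\<exists>q\<ge>1. \<forall>n. p q (unit_seq n) > 0) \<and>
     (\<forall>r\<ge>1. \<exists>q\<ge>1. \<exists>C\<^sub>1>0. \<forall>n k.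
        p r (unit_seq n) * p r (unit_seq k) \<le> C\<^sub>1 * p q (unit_seq (n + k))) \<and>
     (\<forall>m\<ge>2. \<forall>M\<ge>1. \<forall>r\<ge>1. \<exists>\<rho>\<ge>1. \<forall>t\<ge>1. \<exists>\<tau>\<ge>1. \<exists>C\<^sub>2>0. \<forall>k\<le>M. \<forall>n\<ge>M.
        p t (unit_seq (m * n)) * p r (unit_seq (n - k))
          \<le> C\<^sub>2 * p \<tau> (unit_seq (m * n)) powr (1 / real m) * p \<rho> (unit_seq (m * n - k)))"


subsection \<open>Weighted backward shifts and their dynamics\<close>

definition weight_seq :: "cseq \<Rightarrow> bool" where
  "weight_seq w \<longleftrightarrow> w 0 = 1 \<and> (\<forall>n. w n \<noteq> 0)"

definition backward_shift :: "cseq \<Rightarrow> cseq \<Rightarrow> cseq" where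
  "backward_shift w x = (\<lambda>n. w (Suc n) * x (Suc n))"

definition mixing :: "cseq topology \<Rightarrow> (cseq \<Rightarrow> cseq) \<Rightarrow> bool" where
  "mixing T f \<longleftrightarrow>
     (\<forall>U V. openin T U \<and> U \<noteq> {} \<and> openin T V \<and> V \<noteq> {} \<longrightarrow>
        finite (- {n. (f ^^ n) ` U \<inter> V \<noteq> {}}))"

definition HC :: "cseq topology \<Rightarrow> (cseq \<Rightarrow> cseq) \<Rightarrow> cseq set" where
  "HC T f = {x \<in> topspace T. T closure_of (range (\<lambda>n. (f ^^ n) x)) = topspace T}"

definition algebrable_in :: "cseq set \<Rightarrow> cseq set \<Rightarrow> bool" where
  "algebrable_in X H \<longleftrightarrow>
     (\<exists>A\<subseteq>X. subalgebra_seq A \<and> infinitely_generated_alg A \<and> \<not> finitely_generated_alg A \<and>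
        A \<subseteq> H \<union> {0})"

end

theory Submission
  imports Defs
begin

text \<open>Sequences are read as formal power series, the Cauchy product being their product. One
  builds \<open>x = \<Sum> u\<^sub>j\<close> and \<open>y = \<Sum> \<lambda>\<^sub>j u\<^sub>j\<close> from polynomials \<open>u\<^sub>j\<close> and scalars \<open>\<lambda>\<^sub>j\<close> such that
  all nonzero polynomials in \<open>x, y\<close> without constant term are hypercyclic. If such a
  polynomial has total degree \<open>m\<close>, choose \<open>u\<^sub>j\<close> of degree \<open>n\<close> much larger than the degrees of
  the earlier summands: then a shift by nearly \<open>m * n\<close> positions annihilates everything but
  \<open>Q(\<lambda>\<^sub>j) u\<^sub>j ^ m\<close>, where \<open>Q(\<lambda>)\<close> is the value of the top homogeneous part at \<open>(1, \<lambda>)\<close>, hence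
  nonzero for all but finitely many \<open>\<lambda>\<close>. The coefficients of \<open>u\<^sub>j\<close> are fitted so that the shift
  of \<open>u\<^sub>j ^ m\<close> is a prescribed target. Condition (iii) of Property B, the boundedness of the
  shift and \<open>e\<^sub>n / (w\<^sub>1 \<cdots> w\<^sub>n) \<longlonglongrightarrow> 0\<close> make \<open>u\<^sub>j\<close> as small as desired, so that it does not spoil the
  earlier approximations. The algebra is the span of the monomials \<open>x ^ i * y ^ j\<close> with
  \<open>i \<ge> 1\<close>.\<close>

text \<open>The estimates take place in the algebra of sequences whose weighted l1 sums, with the
  weights \<open>||e_n||_q\<close>, are finite for all \<open>q\<close>. It lies in
  \<open>X\<close>, and on it only these numbers and the shift weights matter. The obstacle is that
  prescribing the shift of \<open>u ^ m\<close> is a nonlinear problem. It becomes linear for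
  \<open>u = A + V\<close>, where \<open>A = d * X ^ n\<close> is a single monomial and
  \<open>V\<close> a block well below it: the term \<open>m * A ^ (m - 1) * V\<close> carries the
  target. The price is \<open>A ^ m\<close>, which the shift turns into a multiple of
  \<open>X ^ (2 * M + 1)\<close>; \<open>d\<close> is chosen to make this multiple a small constant.
  So the modulus of \<open>d\<close> is an m-th root, whence the exponent \<open>1 / m\<close> in
  condition (iii), and (iii) also compensates the division by \<open>d ^ (m - 1)\<close> in the
  coefficients of \<open>V\<close>. One vector would not suffice: every subalgebra of the
  polynomials in one variable is finitely generated.\<close>

unbundle no vec_syntax and fps_syntax

subsection \<open>Degrees of polynomials among the power series\<close>

definition degree_le :: "'a::zero fps \<Rightarrow> nat \<Rightarrow> bool" where
  "degree_le f d \<longleftrightarrow> (\<forall>i>d. f $ i = 0)"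

lemma degree_le_mono: "degree_le f d \<Longrightarrow> d \<le> e \<Longrightarrow> degree_le f e"
  by (auto simp: degree_le_def)

lemma degree_le_0 [simp]: "degree_le 0 d"
  and degree_le_1 [simp]: "degree_le (1 :: 'b::zero_neq_one fps) d"
  by (auto simp: degree_le_def)

lemma degree_le_add:
  fixes f :: "'a::comm_ring_1 fps"
  assumes "degree_le f d" "degree_le g d" shows "degree_le (f + g) d"
  using assms by (auto simp: degree_le_def)

lemma degree_le_sum:
  fixes f :: "'b \<Rightarrow> 'a::comm_ring_1 fps"
  assumes "\<And>i. i \<in> I \<Longrightarrow> degree_le (f i) d" shows "degree_le (sum f I) d"
  using assms by (auto simp: degree_le_def fps_sum_nth)

lemma degree_le_mult:
  fixes f :: "'a::comm_ring_1 fps"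
  assumes "degree_le f d" "degree_le g e" shows "degree_le (f * g) (d + e)"
  unfolding degree_le_def
proof (intro allI impI)
  fix n assume n: "d + e < n"
  have "f $ i * g $ (n - i) = 0" if "i \<le> n" for i
    using assms n that by (cases "d < i") (auto simp: degree_le_def)
  then show "(f * g) $ n = 0"
    by (simp add: fps_mult_nth)
qed

lemma degree_le_const_mult:
  fixes f :: "'a::comm_ring_1 fps"
  assumes "degree_le f d" shows "degree_le (fps_const c * f) d"
  using assms by (auto simp: degree_le_def)

lemma degree_le_monom: "degree_le (fps_const c * fps_X ^ n) n" for c :: "'a::comm_ring_1"
  by (auto simp: degree_le_def fps_X_power_iff)

lemma degree_le_power:
  fixes f :: "'a::comm_ring_1 fps"
  assumes "degree_le f d" shows "degree_le (f ^ k) (k * d)"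
  by (induction k) (use assms degree_le_mult in \<open>auto\<close>)

text \<open>What remains of the expansion contains \<open>V\<close> at least twice, hence has degree
  at most \<open>(k - 1) * n + 2 * v\<close>; the bound is written so that the subtraction does not
  truncate. In the induction the next remainder is \<open>A + V\<close> times the old one plus
  \<open>Suc k\<close> times \<open>A ^ k * (V * V)\<close>.\<close>

lemma degree_le_binomial_rest:
  fixes A V :: "'a::comm_ring_1 fps"
  assumes A: "degree_le A n" and V: "degree_le V v" and v: "v \<le> n" "n \<le> 2 * v"
  shows "degree_le ((A + V) ^ Suc k - A ^ Suc k - of_nat (Suc k) * (A ^ k * V)) (k * n + (2 * v - n))"
proof (induction k)
  case 0 show ?case by simp
next
  case (Suc k)
  let ?E = "(A + V) ^ Suc k - A ^ Suc k - of_nat (Suc k) * (A ^ k * V)"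
  have "degree_le (A ^ k * (V * V)) (k * n + (v + v))"
    by (intro degree_le_mult degree_le_power A V)
  then have "degree_le (fps_const (of_nat (Suc k)) * (A ^ k * (V * V))) (Suc k * n + (2 * v - n))"
    using v by (intro degree_le_const_mult) (auto elim!: degree_le_mono)
  moreover have "degree_le (A + V) n"
    using degree_le_add degree_le_mono A V v by blast
  from degree_le_mult[OF this Suc]
  have "degree_le ((A + V) * ?E) (Suc k * n + (2 * v - n))" by (simp add: algebra_simps)
  ultimately have "degree_le (fps_const (of_nat (Suc k)) * (A ^ k * (V * V)) + (A + V) * ?E)
      (Suc k * n + (2 * v - n))"
    by (rule degree_le_add)
  moreover have "(A + V) ^ Suc (Suc k) - A ^ Suc (Suc k) - of_nat (Suc (Suc k)) * (A ^ Suc k * V)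
      = fps_const (of_nat (Suc k)) * (A ^ k * (V * V)) + (A + V) * ?E"
    unfolding fps_of_nat by (simp add: algebra_simps)
  ultimately show ?case by simp
qed

text \<open>Subtraction is truncated at \<open>c = 0\<close>, which is why that case has its own clause.\<close>

definition leading_part :: "nat \<Rightarrow> nat \<Rightarrow> nat \<Rightarrow> 'a::comm_ring_1 fps \<Rightarrow> 'a fps \<Rightarrow> bool" where
  "leading_part n D c F G \<longleftrightarrow> degree_le F (c * n) \<and> degree_le (F - G) ((c - 1) * n + D) \<and> (c = 0 \<longrightarrow> F = G)"

text \<open>Replacing \<open>x + u\<close> by \<open>u\<close> in one factor leaves an error of
  degree \<open>D\<close> instead of \<open>n\<close> from that factor.\<close>

lemma leading_part_Suc:
  fixes x u :: "'a::comm_ring_1 fps"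
  assumes FG: "leading_part n D c F G" and x: "degree_le x D" and u: "degree_le u n" and "D \<le> n"
  shows "leading_part n D (Suc c) ((x + u) * F) (u * G)"
proof -
  have F: "degree_le F (c * n)" using FG by (simp add: leading_part_def)
  have xu: "degree_le (x + u) n"
    using degree_le_add degree_le_mono x u \<open>D \<le> n\<close> by blast
  have 1: "degree_le ((x + u) * F) (Suc c * n)"
    using degree_le_mult[OF xu F] by simp
  have "degree_le (u * (F - G)) (c * n + D)"
  proof (cases c)
    case 0 then show ?thesis using FG by (simp add: leading_part_def)
  next
    case (Suc k)
    have "degree_le (F - G) (k * n + D)" using FG Suc by (simp add: leading_part_def)
    from degree_le_mult[OF u this] show ?thesis using Suc by (simp add: algebra_simps)
  qed
  moreover have "degree_le (x * F) (c * n + D)"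
    using degree_le_mult[OF x F] by (simp add: add.commute)
  ultimately have "degree_le (x * F + u * (F - G)) (c * n + D)"
    by (rule degree_le_add[rotated])
  moreover have "(x + u) * F - u * G = x * F + u * (F - G)" by (simp add: algebra_simps)
  ultimately show ?thesis using 1 by (simp add: leading_part_def)
qed

text \<open>Here \<open>x\<close>, \<open>y\<close> is the pair built so far, of degree at most
  \<open>D\<close>, and \<open>u\<close> is the new block. Above degree
  \<open>(i + j - 1) * n + D\<close> the product agrees with a multiple of a power of
  \<open>u\<close>, and the shift will end in that range.\<close>

lemma leading_part_monomial:
  fixes x y u :: "'a::comm_ring_1 fps"
  assumes x: "degree_le x D" and y: "degree_le y D" and u: "degree_le u n" and "D \<le> n"
  shows "leading_part n D (i + j) ((x + u) ^ i * (y + fps_const c * u) ^ j) (fps_const (c ^ j) * u ^ (i + j))"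
proof -
  have j: "leading_part n D j ((y + fps_const c * u) ^ j) (fps_const (c ^ j) * u ^ j)"
  proof (induction j)
    case 0 show ?case by (simp add: leading_part_def)
  next
    case (Suc j)
    from leading_part_Suc[OF Suc y degree_le_const_mult[OF u, of c] \<open>D \<le> n\<close>]
    show ?case by (simp add: mult_ac flip: fps_const_mult)
  qed
  show ?thesis
  proof (induction i)
    case 0 show ?case using j by simp
  next
    case (Suc i)
    from leading_part_Suc[OF Suc x u \<open>D \<le> n\<close>] show ?case by (simp add: mult_ac)
  qed
qed

subsection \<open>Weighted shifts on Koethe sequence algebras\<close>

text \<open>The data to which the construction is reduced: \<open>a q n\<close> stands for the
  seminorms of the unit sequences, \<open>shift_mixing\<close> is the usual criterion for a weighted
  shift to be mixing, and \<open>root_condition\<close> comes from (iii).\<close>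

locale weighted_shift =
  fixes a :: "nat \<Rightarrow> nat \<Rightarrow> real" and w :: "nat \<Rightarrow> complex"
  assumes a_nonneg: "0 \<le> a q n"
    and a_mono: "q \<le> r \<Longrightarrow> a q n \<le> a r n"
    and a_submult: "a q (n + k) \<le> a q n * a q k"
    and a_pos: "\<exists>q. \<forall>n. 0 < a q n"
    and w_nonzero: "w n \<noteq> 0"
    and shift_bounded: "\<exists>t C. \<forall>n. cmod (w (Suc n)) * a q n \<le> C * a t (Suc n)"
    and shift_mixing: "(\<lambda>n. a q n / cmod (\<Prod>k\<le>n. w k)) \<longlonglongrightarrow> 0"
    and root_condition: "2 \<le> m \<Longrightarrow> 1 \<le> M \<Longrightarrow> \<exists>\<rho>. \<forall>t. \<exists>\<tau> C. \<forall>k\<le>M. \<forall>n\<ge>M.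
        a t (m * n) * a r (n - k) \<le> C * a \<tau> (m * n) powr (1 / real m) * a \<rho> (m * n - k)"
begin

definition W :: "nat \<Rightarrow> complex" where
  "W n = (\<Prod>k\<le>n. w k)"

lemma W_nonzero [simp]: "W n \<noteq> 0"
  by (simp add: W_def w_nonzero)

lemma W_Suc: "W (Suc n) = W n * w (Suc n)"
  by (simp add: W_def)

text \<open>Bounding all partial sums expresses at once that the weighted l1 series converges and
  that its sum is at most \<open>c\<close>.\<close>

definition l1_le :: "nat \<Rightarrow> complex fps \<Rightarrow> real \<Rightarrow> bool" where
  "l1_le q f c \<longleftrightarrow> (\<forall>L. (\<Sum>n<L. cmod (f $ n) * a q n) \<le> c)"

lemma l1_le_nonneg: "l1_le q f c \<Longrightarrow> 0 \<le> c"
  unfolding l1_le_def by (metis lessThan_0 sum.empty)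

lemma l1_le_mono: "l1_le q f c \<Longrightarrow> c \<le> d \<Longrightarrow> l1_le q f d"
  unfolding l1_le_def by (meson order_trans)

lemma l1_le_antimono: "l1_le r f c \<Longrightarrow> q \<le> r \<Longrightarrow> l1_le q f c"
  unfolding l1_le_def
  by (meson a_mono mult_left_mono norm_ge_zero order_trans sum_mono)

lemma l1_le_zero [simp]: "0 \<le> c \<Longrightarrow> l1_le q 0 c"
  by (simp add: l1_le_def)

lemma l1_le_add:
  assumes "l1_le q f c" "l1_le q g d" shows "l1_le q (f + g) (c + d)"
  unfolding l1_le_def
proof
  fix L
  have "(\<Sum>n<L. cmod ((f + g) $ n) * a q n)
      \<le> (\<Sum>n<L. cmod (f $ n) * a q n + cmod (g $ n) * a q n)"
    by (intro sum_mono)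
      (metis a_nonneg distrib_right fps_add_nth mult_right_mono norm_triangle_ineq)
  also have "\<dots> \<le> c + d"
    using assms unfolding l1_le_def sum.distrib by (meson add_mono)
  finally show "(\<Sum>n<L. cmod ((f + g) $ n) * a q n) \<le> c + d" .
qed

lemma l1_le_const_mult:
  assumes "l1_le q f c" shows "l1_le q (fps_const b * f) (cmod b * c)"
  using assms unfolding l1_le_def
  by (simp add: norm_mult mult.assoc mult_left_mono flip: sum_distrib_left)

lemma l1_le_sum:
  assumes "finite I" "\<And>i. i \<in> I \<Longrightarrow> l1_le q (f i) (c i)"
  shows "l1_le q (\<Sum>i\<in>I. f i) (\<Sum>i\<in>I. c i)"
  using assms by (induction I rule: finite_induct) (auto intro: l1_le_add)

lemma l1_le_monom: "l1_le q (fps_const b * fps_X ^ n) (cmod b * a q n)"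
proof -
  have "(\<Sum>i<L. cmod ((fps_const b * fps_X ^ n) $ i) * a q i) \<le> cmod b * a q n" for L
  proof -
    have "(\<Sum>i<L. cmod ((fps_const b * fps_X ^ n) $ i) * a q i)
        = (\<Sum>i<L. if i = n then cmod b * a q n else 0)"
      by (intro sum.cong) (auto simp: fps_X_power_iff)
    also have "\<dots> \<le> cmod b * a q n" by (simp add: a_nonneg)
    finally show ?thesis .
  qed
  then show ?thesis by (simp add: l1_le_def)
qed

lemma degree_le_imp_l1_le:
  assumes "degree_le f d"
  shows "\<exists>c. l1_le q f c"
proof -
  have "(\<Sum>n<L. cmod (f $ n) * a q n) \<le> (\<Sum>n\<le>d. cmod (f $ n) * a q n)" for L
  proof -
    have "(\<Sum>n<L. cmod (f $ n) * a q n) \<le> (\<Sum>n\<in>{..<L} \<union> {..d}. cmod (f $ n) * a q n)"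
      by (intro sum_mono2) (auto simp: a_nonneg)
    also have "\<dots> = (\<Sum>n\<le>d. cmod (f $ n) * a q n)"
      by (intro sum.mono_neutral_right) (use assms in \<open>auto simp: degree_le_def\<close>)
    finally show ?thesis .
  qed
  then show ?thesis by (auto simp: l1_le_def)
qed

text \<open>Submultiplicative weights make weighted l1 an algebra: a partial sum of the product is
  controlled by the triangle \<open>i + j < L\<close>, which lies in the square belonging to the
  product of two partial sums.\<close>

lemma l1_le_mult:
  assumes "l1_le q f c" "l1_le q g d" shows "l1_le q (f * g) (c * d)"
  unfolding l1_le_def
proof
  fix L
  let ?F = "\<lambda>n. cmod (f $ n) * a q n" and ?G = "\<lambda>n. cmod (g $ n) * a q n"
  have "cmod ((f * g) $ n) * a q n \<le> (\<Sum>k\<le>n. ?F k * ?G (n - k))" for n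
  proof -
    have "cmod ((f * g) $ n) * a q n \<le> (\<Sum>k\<le>n. cmod (f $ k) * cmod (g $ (n - k))) * a q n"
      unfolding fps_mult_nth atLeast0AtMost norm_mult[symmetric]
      by (intro mult_right_mono norm_sum a_nonneg)
    also have "\<dots> = (\<Sum>k\<le>n. cmod (f $ k) * cmod (g $ (n - k)) * a q (k + (n - k)))"
      by (simp add: sum_distrib_right)
    also have "\<dots> \<le> (\<Sum>k\<le>n. cmod (f $ k) * cmod (g $ (n - k)) * (a q k * a q (n - k)))"
      by (intro sum_mono mult_left_mono a_submult) auto
    finally show ?thesis by (simp add: mult_ac)
  qed
  then have "(\<Sum>n<L. cmod ((f * g) $ n) * a q n) \<le> (\<Sum>n<L. \<Sum>k\<le>n. ?F k * ?G (n - k))"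
    by (intro sum_mono)
  also have "\<dots> = (\<Sum>(i, j)\<in>{(i, j). i + j < L}. ?F i * ?G j)"
    by (rule sum.triangle_reindex[symmetric])
  also have "\<dots> \<le> (\<Sum>(i, j)\<in>{..<L} \<times> {..<L}. ?F i * ?G j)"
    by (intro sum_mono2) (auto simp: a_nonneg)
  also have "\<dots> = (\<Sum>i<L. ?F i) * (\<Sum>j<L. ?G j)"
    by (simp add: sum_product sum.cartesian_product)
  also have "\<dots> \<le> c * d"
    using assms unfolding l1_le_def
    by (intro mult_mono sum_nonneg) (auto simp: a_nonneg intro: l1_le_nonneg[OF assms(1)])
  finally show "(\<Sum>n<L. cmod ((f * g) $ n) * a q n) \<le> c * d" .
qed

lemma l1_le_one: "\<exists>c. l1_le q 1 c"
  by (rule degree_le_imp_l1_le[of _ 0]) simp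

lemma l1_le_power: "l1_le q f c \<Longrightarrow> \<exists>d. l1_le q (f ^ k) d"
  by (induction k) (auto intro: l1_le_one l1_le_mult)

section \<open>Continuity of multiplication in the weighted l1 seminorms\<close>

lemma l1_le_mult_close:
  assumes f: "l1_le q f c" and g: "l1_le q g d" and "0 < \<epsilon>"
  shows "\<exists>\<eta>>0. \<forall>f' g'. l1_le q (f' - f) \<eta> \<longrightarrow> l1_le q (g' - g) \<eta> \<longrightarrow> l1_le q (f' * g' - f * g) \<epsilon>"
proof (intro exI[of _ "min 1 (\<epsilon> / (1 + c + d))"] conjI allI impI)
  \<comment> \<open>The cap \<open>1\<close> makes the second-order term
    \<open>\<eta> * \<eta>\<close> at most \<open>\<eta>\<close>, so the three terms of the expanded
    difference add up to at most \<open>\<eta> * (1 + c + d)\<close>.\<close>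
  define \<eta> where "\<eta> = min 1 (\<epsilon> / (1 + c + d))"
  have nn: "0 \<le> c" "0 \<le> d" using f g by (auto dest: l1_le_nonneg)
  then show "0 < min 1 (\<epsilon> / (1 + c + d))" using \<open>0 < \<epsilon>\<close> by simp
  then have "0 < \<eta>" by (simp add: \<eta>_def)
  fix f' g' assume "l1_le q (f' - f) (min 1 (\<epsilon> / (1 + c + d)))" "l1_le q (g' - g) (min 1 (\<epsilon> / (1 + c + d)))"
  then have h: "l1_le q (f' - f) \<eta>" "l1_le q (g' - g) \<eta>" by (simp_all add: \<eta>_def)
  have "l1_le q ((f' - f) * (g' - g) + (f' - f) * g + f * (g' - g)) (\<eta> * \<eta> + \<eta> * d + c * \<eta>)"
    by (intro l1_le_add l1_le_mult h f g)
  moreover have "\<eta> * \<eta> + \<eta> * d + c * \<eta> \<le> \<epsilon>"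
  proof -
    have "\<eta> * \<eta> \<le> \<eta>" 
      by (rule mult_left_le) (use \<open>0 < \<eta>\<close> in \<open>auto simp: \<eta>_def\<close>)
    then have "\<eta> * \<eta> + \<eta> * d + c * \<eta> \<le> \<eta> * (1 + c + d)" by (simp add: algebra_simps)
    also have "\<dots> \<le> \<epsilon> / (1 + c + d) * (1 + c + d)"
      by (intro mult_right_mono) (use nn in \<open>auto simp: \<eta>_def\<close>)
    also have "\<dots> = \<epsilon>" using nn by simp
    finally show ?thesis .
  qed
  moreover have "f' * g' - f * g = (f' - f) * (g' - g) + (f' - f) * g + f * (g' - g)"
    by (simp add: algebra_simps)
  ultimately show "l1_le q (f' * g' - f * g) \<epsilon>" by (metis l1_le_mono)
qed

lemma l1_le_power_close:
  assumes f: "l1_le q f c" and "0 < \<epsilon>"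
  shows "\<exists>\<eta>>0. \<forall>f'. l1_le q (f' - f) \<eta> \<longrightarrow> l1_le q (f' ^ k - f ^ k) \<epsilon>"
  using \<open>0 < \<epsilon>\<close>
proof (induction k arbitrary: \<epsilon>)
  case 0 then show ?case by (auto intro: exI[of _ 1])
next
  case (Suc k)
  obtain d where d: "l1_le q (f ^ k) d" using l1_le_power[OF f] by blast
  obtain \<eta> where \<eta>: "\<eta> > 0"
    "\<forall>f' g'. l1_le q (f' - f) \<eta> \<longrightarrow> l1_le q (g' - f ^ k) \<eta> \<longrightarrow> l1_le q (f' * g' - f * f ^ k) \<epsilon>"
    using l1_le_mult_close[OF f d Suc.prems] by blast
  obtain \<theta> where \<theta>: "\<theta> > 0" "\<forall>f'. l1_le q (f' - f) \<theta> \<longrightarrow> l1_le q (f' ^ k - f ^ k) \<eta>"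
    using Suc.IH[OF \<eta>(1)] by blast
  have "l1_le q (f' ^ Suc k - f ^ Suc k) \<epsilon>" if "l1_le q (f' - f) (min \<eta> \<theta>)" for f'
  proof -
    have "l1_le q (f' - f) \<eta>" "l1_le q (f' - f) \<theta>"
      using that by (auto intro: l1_le_mono)
    then show ?thesis using \<eta>(2) \<theta>(2) by simp
  qed
  then show ?case using \<eta>(1) \<theta>(1) by (intro exI[of _ "min \<eta> \<theta>"]) auto
qed

lemma l1_le_monomial_close:
  assumes x: "l1_le q x c" and y: "l1_le q y d" and "0 < \<epsilon>"
  shows "\<exists>\<eta>>0. \<forall>x' y'. l1_le q (x' - x) \<eta> \<longrightarrow> l1_le q (y' - y) \<eta> \<longrightarrow>
    l1_le q (x' ^ i * y' ^ j - x ^ i * y ^ j) \<epsilon>"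
proof -
  obtain c' d' where c': "l1_le q (x ^ i) c'" and d': "l1_le q (y ^ j) d'"
    using l1_le_power x y by metis
  obtain \<eta> where \<eta>: "\<eta> > 0"
    "\<forall>f' g'. l1_le q (f' - x ^ i) \<eta> \<longrightarrow> l1_le q (g' - y ^ j) \<eta> \<longrightarrow> l1_le q (f' * g' - x ^ i * y ^ j) \<epsilon>"
    using l1_le_mult_close[OF c' d' \<open>0 < \<epsilon>\<close>] by blast
  obtain \<alpha> where \<alpha>: "\<alpha> > 0" "\<forall>f'. l1_le q (f' - x) \<alpha> \<longrightarrow> l1_le q (f' ^ i - x ^ i) \<eta>"
    using l1_le_power_close[OF x \<eta>(1)] by blast
  obtain \<beta> where \<beta>: "\<beta> > 0" "\<forall>f'. l1_le q (f' - y) \<beta> \<longrightarrow> l1_le q (f' ^ j - y ^ j) \<eta>"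
    using l1_le_power_close[OF y \<eta>(1)] by blast
  have "l1_le q (x' ^ i * y' ^ j - x ^ i * y ^ j) \<epsilon>"
    if "l1_le q (x' - x) (min \<alpha> \<beta>)" "l1_le q (y' - y) (min \<alpha> \<beta>)" for x' y'
  proof -
    have "l1_le q (x' - x) \<alpha>" "l1_le q (y' - y) \<beta>" using that by (auto intro: l1_le_mono)
    then show ?thesis using \<alpha> \<beta> \<eta> by blast
  qed
  then show ?thesis using \<alpha>(1) \<beta>(1) by (intro exI[of _ "min \<alpha> \<beta>"]) auto
qed

text \<open>Multiplying coefficient \<open>n\<close> by \<open>W n\<close> conjugates the weighted
  shift to the unweighted one; this gives the \<open>N\<close>-th iterate in closed form. The link
  with the iterates of the operator is \<open>backward_shift_pow_fps\<close>.\<close>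

definition shift_pow :: "nat \<Rightarrow> complex fps \<Rightarrow> complex fps" where
  "shift_pow N f = Abs_fps (\<lambda>n. W (n + N) / W n * f $ (n + N))"

lemma shift_pow_add: "shift_pow N (f + g) = shift_pow N f + shift_pow N g"
  and shift_pow_diff: "shift_pow N (f - g) = shift_pow N f - shift_pow N g"
  and shift_pow_const_mult: "shift_pow N (fps_const c * f) = fps_const c * shift_pow N f"
  and shift_pow_zero: "shift_pow N 0 = 0"
  by (simp_all add: shift_pow_def fps_eq_iff algebra_simps)

lemma shift_pow_sum: "shift_pow N (sum f I) = (\<Sum>i\<in>I. shift_pow N (f i))"
  by (induction I rule: infinite_finite_induct) (simp_all add: shift_pow_add shift_pow_zero)

lemma shift_pow_degree_le: "degree_le f d \<Longrightarrow> d < N \<Longrightarrow> shift_pow N f = 0"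
  by (simp add: shift_pow_def fps_eq_iff degree_le_def)

lemma shift_pow_monom:
  "shift_pow N (fps_const c * fps_X ^ (N + i)) = fps_const (c * W (N + i) / W i) * fps_X ^ i"
  by (auto simp: shift_pow_def fps_eq_iff fps_X_power_iff add.commute)

text \<open>Iterates \<open>shift_bounded\<close>, raising the seminorm index when necessary. One
  pair \<open>t\<close>, \<open>C\<close> has to serve all \<open>k \<le> N\<close>, because
  \<open>root_bound\<close> uses it for every offset \<open>k\<close> up to
  \<open>M\<close>.\<close>

lemma shift_pow_bounded_weights:
  "\<exists>t C. 0 < C \<and> (\<forall>k\<le>N. \<forall>n. cmod (W (n + k)) * a q n \<le> C * cmod (W n) * a t (n + k))"
proof (induction N)
  case 0
  show ?case by (rule exI[of _ q], rule exI[of _ 1]) simp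
next
  case (Suc N)
  then obtain t C where C: "0 < C"
    and tC: "\<And>k n. k \<le> N \<Longrightarrow> cmod (W (n + k)) * a q n \<le> C * cmod (W n) * a t (n + k)" by blast
  obtain t' C' where t'C': "\<And>n. cmod (w (Suc n)) * a t n \<le> C' * a t' (Suc n)"
    using shift_bounded by blast
  let ?K = "C * max 1 C'"
  have "cmod (W (n + k)) * a q n \<le> ?K * cmod (W n) * a (max t t') (n + k)" if "k \<le> Suc N" for k n
  proof (cases "k \<le> N")
    case True
    have "cmod (W (n + k)) * a q n \<le> C * cmod (W n) * a t (n + k)" using tC[OF True] .
    also have "\<dots> \<le> C * max 1 C' * cmod (W n) * a (max t t') (n + k)"
      using C by (intro mult_mono mult_right_mono a_mono) (auto simp: a_nonneg)
    finally show ?thesis .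
  next
    case False
    then have k: "k = Suc N" using that by simp
    have "cmod (W (n + k)) * a q n = cmod (w (Suc (n + N))) * (cmod (W (n + N)) * a q n)"
      by (simp add: k W_Suc norm_mult)
    also have "\<dots> \<le> cmod (w (Suc (n + N))) * (C * cmod (W n) * a t (n + N))"
      by (intro mult_left_mono tC) auto
    also have "\<dots> = C * cmod (W n) * (cmod (w (Suc (n + N))) * a t (n + N))" by simp
    also have "\<dots> \<le> C * cmod (W n) * (C' * a t' (Suc (n + N)))"
      using C by (intro mult_left_mono t'C') auto
    also have "\<dots> \<le> C * cmod (W n) * (max 1 C' * a (max t t') (Suc (n + N)))"
      using C by (intro mult_left_mono mult_mono a_mono) (auto simp: a_nonneg)
    finally show ?thesis by (simp add: k mult_ac)
  qed
  moreover have "0 < ?K" using C by simp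
  ultimately show ?case by blast
qed

lemma shift_pow_bounded: "\<exists>t C. 0 < C \<and> (\<forall>f c. l1_le t f c \<longrightarrow> l1_le q (shift_pow N f) (C * c))"
proof -
  obtain t C where C: "0 < C"
    and tC: "\<And>n. cmod (W (n + N)) * a q n \<le> C * cmod (W n) * a t (n + N)"
    using shift_pow_bounded_weights[of N q] by blast
  have "l1_le q (shift_pow N f) (C * c)" if f: "l1_le t f c" for f c
    unfolding l1_le_def
  proof
    fix L
    have "cmod (shift_pow N f $ n) * a q n \<le> C * (cmod (f $ (n + N)) * a t (n + N))" for n
    proof -
      have "cmod (shift_pow N f $ n) * a q n
          = cmod (f $ (n + N)) / cmod (W n) * (cmod (W (n + N)) * a q n)"
        by (simp add: shift_pow_def norm_mult norm_divide)
      also have "\<dots> \<le> cmod (f $ (n + N)) / cmod (W n) * (C * cmod (W n) * a t (n + N))"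
        by (intro mult_left_mono tC) auto
      also have "\<dots> = C * (cmod (f $ (n + N)) * a t (n + N))" by simp
      finally show ?thesis .
    qed
    then have "(\<Sum>n<L. cmod (shift_pow N f $ n) * a q n)
        \<le> C * (\<Sum>n<L. cmod (f $ (n + N)) * a t (n + N))"
      unfolding sum_distrib_left by (intro sum_mono)
    also have "(\<Sum>n<L. cmod (f $ (n + N)) * a t (n + N)) = (\<Sum>n\<in>{N..<N + L}. cmod (f $ n) * a t n)"
      by (rule sum.reindex_bij_witness[of _ "\<lambda>n. n - N" "\<lambda>n. n + N"]) auto
    also have "\<dots> \<le> (\<Sum>n<N + L. cmod (f $ n) * a t n)"
      by (intro sum_mono2) (auto simp: a_nonneg)
    also have "\<dots> \<le> c" using f by (auto simp: l1_le_def)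
    finally show "(\<Sum>n<L. cmod (shift_pow N f $ n) * a q n) \<le> C * c"
      using C by simp
  qed
  then show ?thesis using C by blast
qed

section \<open>Small polynomials whose m-th power has a prescribed shift\<close>

lemma root_condition':
  assumes "1 \<le> m" "1 \<le> M"
  shows "\<exists>\<rho>. \<forall>t. \<exists>\<tau> C. \<forall>k\<le>M. \<forall>n\<ge>M.
    a t (m * n) * a r (n - k) \<le> C * a \<tau> (m * n) powr (1 / real m) * a \<rho> (m * n - k)"
proof (cases "m = 1")
  case True
  show ?thesis
    by (rule exI[of _ r], intro allI, rule_tac x = t in exI, rule exI[of _ 1])
      (simp add: True a_nonneg)
next
  case False
  then show ?thesis using assms by (intro root_condition) auto
qed

text \<open>Boundedness of \<open>k\<close> shift steps trades
  \<open>a \<rho> (m * n - k) * cmod (W (m * n))\<close> for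
  \<open>cmod (W (m * n - k)) * a s (m * n)\<close>. With \<open>t\<close> above \<open>s\<close>,
  the factor \<open>a t (m * n)\<close> on the left of (iii) absorbs the new one; hence (iii) must
  provide \<open>\<rho>\<close> before \<open>t\<close>. Taking \<open>t\<close> above
  \<open>q0\<close> as well makes this factor positive, so that it can be cancelled.\<close>

lemma root_bound:
  assumes "1 \<le> m" "1 \<le> M"
  shows "\<exists>\<tau> C. 0 < C \<and> (\<forall>k\<le>M. \<forall>n\<ge>M.
    a r (n - k) * cmod (W (m * n)) \<le> C * cmod (W (m * n - k)) * a \<tau> (m * n) powr (1 / real m))"
proof -
  obtain \<rho> where \<rho>: "\<And>t. \<exists>\<tau> C. \<forall>k\<le>M. \<forall>n\<ge>M.
      a t (m * n) * a r (n - k) \<le> C * a \<tau> (m * n) powr (1 / real m) * a \<rho> (m * n - k)"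
    using root_condition'[OF assms] by meson
  obtain s B where B: "0 < B"
    and sB: "\<And>k n. k \<le> M \<Longrightarrow> cmod (W (n + k)) * a \<rho> n \<le> B * cmod (W n) * a s (n + k)"
    using shift_pow_bounded_weights[of M \<rho>] by blast
  obtain q0 where q0: "\<And>n. 0 < a q0 n" using a_pos by blast
  define t where "t = max s q0"
  have t_pos: "0 < a t n" for n
    using q0[of n] a_mono[of q0 t n] by (simp add: t_def)
  obtain \<tau> C where C: "\<And>k n. k \<le> M \<Longrightarrow> n \<ge> M \<Longrightarrow>
      a t (m * n) * a r (n - k) \<le> C * a \<tau> (m * n) powr (1 / real m) * a \<rho> (m * n - k)"
    using \<rho>[of t] by blast
  have "a r (n - k) * cmod (W (m * n)) \<le> max 1 C * B * cmod (W (m * n - k)) * a \<tau> (m * n) powr (1 / real m)"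
    if "k \<le> M" "M \<le> n" for k n
  proof -
    let ?R = "a \<tau> (m * n) powr (1 / real m)"
    have "n \<le> m * n" using assms by simp
    then have kn: "k \<le> m * n" using that by linarith
    have "a t (m * n) * (a r (n - k) * cmod (W (m * n)))
        = (a t (m * n) * a r (n - k)) * cmod (W (m * n))" by simp
    also have "\<dots> \<le> (C * ?R * a \<rho> (m * n - k)) * cmod (W (m * n))"
      by (intro mult_right_mono C that) auto
    also have "\<dots> \<le> (max 1 C * ?R * a \<rho> (m * n - k)) * cmod (W (m * n))"
      by (intro mult_right_mono) (auto simp: a_nonneg)
    also have "\<dots> = max 1 C * ?R * (cmod (W (m * n - k + k)) * a \<rho> (m * n - k))"
      using kn by simp
    also have "\<dots> \<le> max 1 C * ?R * (B * cmod (W (m * n - k)) * a s (m * n - k + k))"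
      by (intro mult_left_mono sB that) auto
    also have "\<dots> \<le> max 1 C * ?R * (B * cmod (W (m * n - k)) * a t (m * n - k + k))"
      by (intro mult_left_mono a_mono) (use B in \<open>auto simp: t_def\<close>)
    also have "\<dots> = a t (m * n) * (max 1 C * B * cmod (W (m * n - k)) * ?R)"
      using kn by simp
    finally show ?thesis using t_pos[of "m * n"] by simp
  qed
  moreover have "0 < max 1 C * B" using B by simp
  ultimately show ?thesis by blast
qed

text \<open>The two blocks of \<open>u\<close> are separated by a gap longer than \<open>M\<close>, so that after the shift by
  \<open>N\<close> only the two leading terms of the binomial expansion of \<open>u ^ m\<close> survive.\<close>

lemma power_two_blocks:
  fixes c :: "nat \<Rightarrow> complex"
  assumes m: "1 \<le> m" and n: "2 * M + 2 \<le> n"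
    and N: "N = m * n - (2 * M + 1)"
    and u: "u = fps_const d * fps_X ^ n + (\<Sum>i\<le>M. fps_const (c i) * fps_X ^ (n - (2 * M + 1) + i))"
  shows "shift_pow N (u ^ m) =
    (\<Sum>i\<le>M. fps_const (of_nat m * d ^ (m - 1) * c i * W (N + i) / W i) * fps_X ^ i)
    + fps_const (d ^ m * W (m * n) / W (2 * M + 1)) * fps_X ^ (2 * M + 1)"
proof -
  obtain k where k: "m = Suc k" using m by (cases m) auto
  define l where "l = n - (2 * M + 1)"
  have nl: "n = l + (2 * M + 1)" using n by (simp add: l_def)
  have Nl: "N = k * n + l" by (simp add: N k nl)
  have mn: "m * n = N + (2 * M + 1)" by (simp add: Nl k nl)
  define A where "A = fps_const d * fps_X ^ n"
  define V where "V = (\<Sum>i\<le>M. fps_const (c i) * fps_X ^ (l + i))"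
  have u: "u = A + V" by (simp add: u A_def V_def l_def)
  have A: "degree_le A n" unfolding A_def by (rule degree_le_monom)
  have V: "degree_le V (n - (M + 1))" unfolding V_def
    by (intro degree_le_sum degree_le_mono[OF degree_le_monom]) (simp add: nl)
  have "degree_le (u ^ m - A ^ m - of_nat m * (A ^ k * V)) (k * n + (2 * (n - (M + 1)) - n))"
    unfolding u k by (rule degree_le_binomial_rest[OF A V]) (use n in auto)
  \<comment> \<open>The left side equals \<open>N - 1\<close>: \<open>2 * M + 1\<close> is the
    smallest offset that pushes all terms of second order in \<open>V\<close> below
    \<open>N\<close>.\<close>
  moreover have "k * n + (2 * (n - (M + 1)) - n) < N" using n by (simp add: Nl nl)
  ultimately have "shift_pow N (u ^ m - A ^ m - of_nat m * (A ^ k * V)) = 0"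
    by (rule shift_pow_degree_le)
  then have "shift_pow N (u ^ m) = shift_pow N (of_nat m * (A ^ k * V)) + shift_pow N (A ^ m)"
    unfolding shift_pow_diff by (simp add: algebra_simps)
  moreover have "A ^ m = fps_const (d ^ m) * fps_X ^ (N + (2 * M + 1))"
    by (simp only: A_def power_mult_distrib fps_const_power mn[symmetric] power_mult mult.commute[of m n])
  moreover have "of_nat m * (A ^ k * V) = (\<Sum>i\<le>M. fps_const (of_nat m * d ^ (m - 1) * c i) * fps_X ^ (N + i))"
  proof -
    have "A ^ k = fps_const (d ^ k) * fps_X ^ (k * n)"
      by (simp only: A_def power_mult_distrib fps_const_power power_mult mult.commute[of k n])
    then have "of_nat m * (A ^ k * V) = (\<Sum>i\<le>M. of_nat m * (fps_const (d ^ k) * fps_X ^ (k * n) * (fps_const (c i) * fps_X ^ (l + i))))"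
      by (simp add: V_def sum_distrib_left)
    also have "\<dots> = (\<Sum>i\<le>M. fps_const (of_nat m * d ^ (m - 1) * c i) * fps_X ^ (N + i))"
    proof (intro sum.cong refl)
      fix i
      have "fps_X ^ (N + i) = (fps_X ^ (k * n) * fps_X ^ (l + i) :: complex fps)"
        by (simp add: Nl power_add)
      then show "of_nat m * (fps_const (d ^ k) * fps_X ^ (k * n) * (fps_const (c i) * fps_X ^ (l + i)))
          = fps_const (of_nat m * d ^ (m - 1) * c i) * fps_X ^ (N + i)"
        by (simp add: k fps_of_nat[symmetric] mult_ac flip: fps_const_mult)
    qed
    finally show ?thesis .
  qed
  ultimately show ?thesis
    by (simp only: shift_pow_sum shift_pow_monom) (simp add: mn)
qed

text \<open>The shift of \<open>u ^ m\<close> is \<open>z\<close> plus an error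
  \<open>\<delta> * X ^ (2 * M + 1)\<close> coming from the top monomial of \<open>u\<close>. Its
  coefficient \<open>d\<close> is an m-th root that makes this error independent of
  \<open>n\<close>, so one \<open>z'\<close> serves all large \<open>n\<close>; the coefficients of
  the lower block then solve linear equations.\<close>

lemma perturbation:
  assumes m: "1 \<le> m" and "0 < \<epsilon>" and z: "degree_le z M"
  shows "\<exists>z'. l1_le q (z' - z) \<epsilon> \<and> (\<forall>\<^sub>F n in sequentially. \<exists>u. degree_le u n \<and> l1_le r u \<epsilon> \<and>
    (\<forall>i < n - (2 * M + 1). u $ i = 0) \<and> shift_pow (m * n - (2 * M + 1)) (u ^ m) = z')"
proof -
  define M' where "M' = 2 * M + 1"
  define \<delta> where "\<delta> = \<epsilon> / (1 + a q M')"
  have \<delta>: "0 < \<delta>" using \<open>0 < \<epsilon>\<close> a_nonneg[of q M'] by (simp add: \<delta>_def)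
  have "\<delta> * a q M' \<le> \<epsilon>"
    using \<open>0 < \<epsilon>\<close> a_nonneg[of q M'] by (simp add: \<delta>_def field_simps)
  define z' where "z' = z + fps_const (of_real \<delta>) * fps_X ^ M'"
  have "l1_le q (z' - z) \<epsilon>"
    using l1_le_monom[of q "of_real \<delta>" M'] \<open>\<delta> * a q M' \<le> \<epsilon>\<close> \<delta>
    by (auto simp: z'_def intro: l1_le_mono)
  obtain \<tau> C where C: "0 < C" and root: "\<And>k n. k \<le> M' \<Longrightarrow> n \<ge> M' \<Longrightarrow>
      a r (n - k) * cmod (W (m * n)) \<le> C * cmod (W (m * n - k)) * a \<tau> (m * n) powr (1 / real m)"
    using root_bound[OF m, of M' r] by (auto simp: M'_def)
  \<comment> \<open>This is \<open>cmod d * a \<tau> (m * n) powr (1 / real m)\<close> for the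
    \<open>d\<close> that is chosen below for each \<open>n\<close>, written without
    \<open>d\<close> so that its limit is available first.\<close>
  define h where "h n = (\<delta> * cmod (W M') * (a \<tau> (m * n) / cmod (W (m * n)))) powr (1 / real m)" for n
  have "(\<lambda>n. a \<tau> (m * n) / cmod (W (m * n))) \<longlonglongrightarrow> 0"
  proof -
    have "filterlim (\<lambda>n. m * n) at_top sequentially"
      using m by (intro filterlim_subseq) (auto simp: strict_mono_def)
    from filterlim_compose[OF shift_mixing[of \<tau>] this] show ?thesis by (simp add: W_def)
  qed
  then have "(\<lambda>n. \<delta> * cmod (W M') * (a \<tau> (m * n) / cmod (W (m * n)))) \<longlonglongrightarrow> 0"
    by (rule tendsto_mult_right_zero)
  then have "h \<longlonglongrightarrow> 0" unfolding h_def
    by (rule tendsto_zero_powrI[OF _ tendsto_const]) (use m in \<open>auto simp: a_nonneg \<delta> less_imp_le\<close>)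
  \<comment> \<open>\<open>B * h n\<close> will bound the l1 norm of \<open>u\<close>: the summand
    \<open>C\<close> accounts for the top monomial, the sum for the coefficients of the lower
    block.\<close>
  define B where "B = C + (\<Sum>i\<le>M. cmod (z $ i * W i) * C / (m * \<delta> * cmod (W M')))"
  from \<open>h \<longlonglongrightarrow> 0\<close> have "(\<lambda>n. B * h n) \<longlonglongrightarrow> 0" by (rule tendsto_mult_right_zero)
  then have "\<forall>\<^sub>F n in sequentially. B * h n < \<epsilon>"
    by (rule order_tendstoD) fact
  moreover have "\<forall>\<^sub>F n in sequentially. M' + 1 \<le> n" by (rule eventually_ge_at_top)
  ultimately have "\<forall>\<^sub>F n in sequentially. \<exists>u. degree_le u n \<and> l1_le r u \<epsilon> \<and>
    (\<forall>i < n - M'. u $ i = 0) \<and> shift_pow (m * n - M') (u ^ m) = z'"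
  proof eventually_elim
    case (elim n)
    define N where "N = m * n - M'"
    define l where "l = n - M'"
    have n: "n = l + M'" using elim by (simp add: l_def)
    have "n \<le> m * n" using m by simp
    then have N: "m * n = N + M'" using elim unfolding N_def by linarith
    obtain d where "of_real \<delta> * W M' / W (m * n) = d ^ m"
      using m by (elim exists_complex_root[of m, rotated]) simp
    then have d: "d ^ m = of_real \<delta> * W M' / W (m * n)" by simp
    moreover have "of_real \<delta> * W M' / W (m * n) \<noteq> 0" using \<delta> by simp
    ultimately have "d \<noteq> 0" using m by (metis One_nat_def not_one_le_zero power_0_left)
    have dm: "cmod d ^ m = \<delta> * cmod (W M') / cmod (W (m * n))"
      using arg_cong[OF d, of cmod] \<delta> by (simp add: norm_mult norm_divide norm_power)
    have h: "h n = cmod d * a \<tau> (m * n) powr (1 / real m)"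
    proof -
      have "h n = (cmod d ^ m * a \<tau> (m * n)) powr (1 / real m)"
        unfolding h_def dm by simp
      also have "\<dots> = (cmod d ^ m) powr (1 / real m) * a \<tau> (m * n) powr (1 / real m)"
        by (rule powr_mult)
      also have "(cmod d ^ m) powr (1 / real m) = cmod d"
        using \<open>d \<noteq> 0\<close> m by (simp add: powr_powr flip: powr_realpow)
      finally show ?thesis .
    qed
    \<comment> \<open>\<open>c i\<close> undoes the factor
      \<open>of_nat m * d ^ (m - 1) * W (N + i) / W i\<close> produced by
      \<open>power_two_blocks\<close>.\<close>
    define c where "c i = z $ i * W i / (W (N + i) * (of_nat m * d ^ (m - 1)))" for i
    define u where "u = fps_const d * fps_X ^ n + (\<Sum>i\<le>M. fps_const (c i) * fps_X ^ (l + i))"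
    have "degree_le u n" unfolding u_def
      by (intro degree_le_add degree_le_sum degree_le_mono[OF degree_le_monom])
        (auto simp: n M'_def)
    moreover have "\<forall>i < n - M'. u $ i = 0"
      by (auto simp: u_def fps_sum_nth fps_X_power_iff n)
    moreover have "shift_pow N (u ^ m) = z'"
    proof -
      have "shift_pow N (u ^ m) =
        (\<Sum>i\<le>M. fps_const (of_nat m * d ^ (m - 1) * c i * W (N + i) / W i) * fps_X ^ i)
        + fps_const (d ^ m * W (m * n) / W M') * fps_X ^ M'"
        unfolding M'_def
        by (rule power_two_blocks) (use elim m in \<open>auto simp: u_def l_def N_def M'_def\<close>)
      also have "(\<Sum>i\<le>M. fps_const (of_nat m * d ^ (m - 1) * c i * W (N + i) / W i) * fps_X ^ i)
          = (\<Sum>i\<le>M. fps_const (z $ i) * fps_X ^ i)"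
        using \<open>d \<noteq> 0\<close> m by (intro sum.cong) (auto simp: c_def)
      also have "\<dots> = z"
        using z by (auto simp: fps_eq_iff fps_sum_nth fps_X_power_iff degree_le_def not_le
            if_distrib[of "(*) _"] cong: if_cong)
      finally show ?thesis by (simp add: z'_def d)
    qed
    moreover have "l1_le r u \<epsilon>"
    proof (rule l1_le_mono)
      show "l1_le r u (cmod d * a r n + (\<Sum>i\<le>M. cmod (c i) * a r (l + i)))"
        unfolding u_def by (intro l1_le_add l1_le_sum l1_le_monom) auto
      have "cmod d * a r n \<le> C * h n"
      proof -
        have "a r n \<le> C * a \<tau> (m * n) powr (1 / real m)" using root[of 0 n] elim by simp
        from mult_left_mono[OF this, of "cmod d"] show ?thesis by (simp add: h mult_ac)
      qed
      moreover have "cmod (c i) * a r (l + i) \<le> cmod (z $ i * W i) * C / (m * \<delta> * cmod (W M')) * h n"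
        if "i \<le> M" for i
      proof -
        \<comment> \<open>Position \<open>l + i\<close> lies \<open>M' - i\<close> below
          \<open>n\<close>, and \<open>N + i\<close> lies \<open>M' - i\<close> below
          \<open>m * n\<close>.\<close>
        have ri: "a r (l + i) * cmod (W (m * n)) \<le> C * cmod (W (N + i)) * a \<tau> (m * n) powr (1 / real m)"
          using root[of "M' - i" n] elim that n N by (simp add: M'_def)
        have "cmod d ^ m = cmod d * cmod d ^ (m - 1)" using m by (cases m) auto
        \<comment> \<open>This turns the division by the possibly tiny \<open>d ^ (m - 1)\<close>
          into a multiplication by \<open>d\<close> and \<open>W (m * n)\<close>, up to constants;
          \<open>root_bound\<close> controls the second factor, and the first one completes
          \<open>h n\<close>.\<close>
        then have dm1: "cmod d ^ (m - 1) = \<delta> * cmod (W M') / (cmod (W (m * n)) * cmod d)"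
          using dm \<open>d \<noteq> 0\<close> by (simp add: field_simps)
        have "cmod (c i) * a r (l + i)
            = cmod (z $ i * W i) * cmod d / (cmod (W (N + i)) * m * \<delta> * cmod (W M')) * (a r (l + i) * cmod (W (m * n)))"
          using dm1 \<delta> m \<open>d \<noteq> 0\<close>
          by (simp add: c_def norm_mult norm_divide norm_power field_simps)
        also have "\<dots> \<le> cmod (z $ i * W i) * cmod d / (cmod (W (N + i)) * m * \<delta> * cmod (W M')) * (C * cmod (W (N + i)) * a \<tau> (m * n) powr (1 / real m))"
          using \<delta> by (intro mult_left_mono ri) auto
        also have "\<dots> = cmod (z $ i * W i) * C / (m * \<delta> * cmod (W M')) * h n"
          by (simp add: h mult_ac)
        finally show ?thesis .
      qed
      ultimately have "cmod d * a r n + (\<Sum>i\<le>M. cmod (c i) * a r (l + i)) \<le> B * h n"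
        unfolding B_def distrib_right sum_distrib_right by (intro add_mono sum_mono) auto
      then show "cmod d * a r n + (\<Sum>i\<le>M. cmod (c i) * a r (l + i)) \<le> \<epsilon>" using elim by simp
    qed
    ultimately show ?case unfolding N_def by blast
  qed
  with \<open>l1_le q (z' - z) \<epsilon>\<close> show ?thesis unfolding M'_def by blast
qed

subsection \<open>Two algebraically independent hypercyclic vectors\<close>

lemma dominant_perturbation:
  assumes x: "degree_le x D" and y: "degree_le y D" and z: "degree_le z M"
    and m: "1 \<le> m" and "0 < \<epsilon>"
  shows "\<exists>u d N z'. degree_le u d \<and> l1_le r u \<epsilon> \<and> (\<forall>i<L. u $ i = 0) \<and> l1_le q (z' - z) \<epsilon> \<and>
    (\<forall>i j. i + j \<le> m \<longrightarrow> shift_pow N ((x + u) ^ i * (y + fps_const c * u) ^ j)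
       = (if i + j = m then fps_const (c ^ j) * z' else 0))"
proof -
  obtain z' where z': "l1_le q (z' - z) \<epsilon>" and ev: "\<forall>\<^sub>F n in sequentially. \<exists>u. degree_le u n \<and> l1_le r u \<epsilon> \<and>
    (\<forall>i < n - (2 * M + 1). u $ i = 0) \<and> shift_pow (m * n - (2 * M + 1)) (u ^ m) = z'"
    using perturbation[OF m \<open>0 < \<epsilon>\<close> z, of q r] by blast
  then obtain K where K: "\<And>n. K \<le> n \<Longrightarrow> \<exists>u. degree_le u n \<and> l1_le r u \<epsilon> \<and>
    (\<forall>i < n - (2 * M + 1). u $ i = 0) \<and> shift_pow (m * n - (2 * M + 1)) (u ^ m) = z'"
    unfolding eventually_sequentially by blast
  \<comment> \<open>The part \<open>2 * M + 2 + D\<close> ensures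
    \<open>(m - 1) * n + D < N\<close>, so the shift annihilates the monomials of degree below
    \<open>m\<close> and all mixed terms in degree \<open>m\<close>. The part \<open>L\<close> keeps
    the first \<open>L\<close> coefficients of \<open>u\<close> zero.\<close>
  define n where "n = K + (2 * M + 2 + D + L)"
  have n: "2 * M + 2 + D + L \<le> n" by (simp add: n_def)
  have "K \<le> n" by (simp add: n_def)
  from K[OF this]
  obtain u where u: "degree_le u n" "l1_le r u \<epsilon>" "\<forall>i < n - (2 * M + 1). u $ i = 0"
    "shift_pow (m * n - (2 * M + 1)) (u ^ m) = z'" by blast
  define N where "N = m * n - (2 * M + 1)"
  obtain k where k: "m = Suc k" using m by (cases m) auto
  have N: "k * n + D < N" using n by (simp add: N_def k)
  have "shift_pow N ((x + u) ^ i * (y + fps_const c * u) ^ j)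
       = (if i + j = m then fps_const (c ^ j) * z' else 0)" if ij: "i + j \<le> m" for i j
  proof -
    let ?F = "(x + u) ^ i * (y + fps_const c * u) ^ j" and ?G = "fps_const (c ^ j) * u ^ (i + j)"
    have leading_part: "leading_part n D (i + j) ?F ?G"
      by (rule leading_part_monomial[OF x y u(1)]) (use n in simp)
    show ?thesis
    proof (cases "i + j = m")
      case True
      then have "degree_le (?F - ?G) (k * n + D)" using leading_part by (simp add: leading_part_def k)
      then have "shift_pow N (?F - ?G) = 0" using N by (rule shift_pow_degree_le)
      then show ?thesis using u(4) True
        by (simp add: shift_pow_diff shift_pow_const_mult N_def)
    next
      case False
      then have "(i + j) * n \<le> k * n" using ij by (intro mult_right_mono) (auto simp: k)
      then have "(i + j) * n < N" using N by linarith
      moreover have "degree_le ?F ((i + j) * n)" using leading_part by (simp add: leading_part_def)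
      ultimately show ?thesis using False by (simp only: shift_pow_degree_le if_False)
    qed
  qed
  moreover have "\<forall>i<L. u $ i = 0" using u(3) n by auto
  ultimately show ?thesis using u(1,2) z' by blast
qed

text \<open>One shift has to treat all monomials of degree at most \<open>m\<close> simultaneously:
  it then sends a polynomial of degree \<open>m\<close> close to \<open>z\<close> times the value of
  its top homogeneous part at \<open>(1, c)\<close>.\<close>

definition shift_approximates :: "nat \<Rightarrow> nat \<Rightarrow> nat \<Rightarrow> complex \<Rightarrow> complex fps \<Rightarrow> real \<Rightarrow> complex fps \<Rightarrow> complex fps \<Rightarrow> bool" where
  "shift_approximates N q m c z \<epsilon> x y \<longleftrightarrow> (\<forall>i j. i + j \<le> m \<longrightarrow>
     l1_le q (shift_pow N (x ^ i * y ^ j) - (if i + j = m then fps_const (c ^ j) * z else 0)) \<epsilon>)"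

text \<open>The exact identities become an open condition: finitely many monomials are involved, and
  each of them followed by the shift is continuous. So the approximation survives all later
  corrections that stay within \<open>\<eta>\<close> in the seminorm \<open>t\<close>. The bound on
  \<open>c\<close> prevents the factor \<open>c ^ j\<close> from enlarging the error
  \<open>z' - z\<close>.\<close>

lemma robust_perturbation:
  assumes x: "degree_le x D" and y: "degree_le y D" and z: "degree_le z M"
    and m: "1 \<le> m" and c: "cmod c \<le> 1" and "0 < e" "0 < \<epsilon>"
  shows "\<exists>u d N t \<eta>. degree_le u d \<and> l1_le r u e \<and> (\<forall>i<L. u $ i = 0) \<and> 0 < \<eta> \<and>
    (\<forall>s s'. l1_le t s \<eta> \<longrightarrow> l1_le t s' \<eta> \<longrightarrow> shift_approximates N q m c z \<epsilon> (x + u + s) (y + fps_const c * u + s'))"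
proof -
  obtain u d N z' where u: "degree_le u d" "l1_le r u (min e (\<epsilon> / 2))" "\<forall>i<L. u $ i = 0"
    and z': "l1_le q (z' - z) (min e (\<epsilon> / 2))"
    and main: "\<And>i j. i + j \<le> m \<Longrightarrow> shift_pow N ((x + u) ^ i * (y + fps_const c * u) ^ j)
       = (if i + j = m then fps_const (c ^ j) * z' else 0)"
    using dominant_perturbation[OF x y z m, of "min e (\<epsilon> / 2)" r L q c] \<open>0 < e\<close> \<open>0 < \<epsilon>\<close> by auto
  obtain t C where C: "0 < C" and t: "\<And>f b. l1_le t f b \<Longrightarrow> l1_le q (shift_pow N f) (C * b)"
    using shift_pow_bounded by blast
  let ?x = "x + u" and ?y = "y + fps_const c * u"
  have "\<exists>b. l1_le t ?x b" "\<exists>b. l1_le t ?y b"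
    by (rule degree_le_imp_l1_le[of _ "max D d"]; intro degree_le_add degree_le_const_mult
        degree_le_mono[OF x] degree_le_mono[OF y] degree_le_mono[OF u(1)]; simp)+
  then obtain bx b_y where b: "l1_le t ?x bx" "l1_le t ?y b_y" by blast
  \<comment> \<open>\<open>C\<close> bounds the shift from seminorm \<open>t\<close> to seminorm
    \<open>q\<close>; the other half of \<open>\<epsilon>\<close> is spent on replacing
    \<open>z'\<close> by \<open>z\<close>.\<close>
  have "0 < \<epsilon> / 2 / C" using C \<open>0 < \<epsilon>\<close> by simp
  from l1_le_monomial_close[OF b this]
  have "\<forall>ij. \<exists>\<eta>>0. \<forall>x' y'. l1_le t (x' - ?x) \<eta> \<longrightarrow> l1_le t (y' - ?y) \<eta> \<longrightarrow>
    l1_le t (x' ^ fst ij * y' ^ snd ij - ?x ^ fst ij * ?y ^ snd ij) (\<epsilon> / 2 / C)" by blast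
  then obtain h where h: "\<And>ij. h ij > 0" "\<And>ij x' y'. l1_le t (x' - ?x) (h ij) \<Longrightarrow> l1_le t (y' - ?y) (h ij) \<Longrightarrow>
    l1_le t (x' ^ fst ij * y' ^ snd ij - ?x ^ fst ij * ?y ^ snd ij) (\<epsilon> / 2 / C)" by metis
  define \<eta> where "\<eta> = Min (h ` ({..m} \<times> {..m}))"
  have "0 < \<eta>" unfolding \<eta>_def using h(1) by (subst Min_gr_iff) auto
  have "shift_approximates N q m c z \<epsilon> (?x + s) (?y + s')" if s: "l1_le t s \<eta>" and s': "l1_le t s' \<eta>" for s s'
    unfolding shift_approximates_def
  proof (intro allI impI)
    fix i j assume ij: "i + j \<le> m"
    have "\<eta> \<le> h (i, j)" unfolding \<eta>_def using ij by (intro Min_le) auto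
    then have "l1_le t (((?x + s) ^ i * (?y + s') ^ j) - ?x ^ i * ?y ^ j) (\<epsilon> / 2 / C)"
      using h(2)[of "?x + s" "(i, j)" "?y + s'"] s s' by (auto intro: l1_le_mono)
    from t[OF this] have 1: "l1_le q (shift_pow N ((?x + s) ^ i * (?y + s') ^ j) - shift_pow N (?x ^ i * ?y ^ j)) (\<epsilon> / 2)"
      using C by (simp add: shift_pow_diff)
    have 2: "l1_le q (shift_pow N (?x ^ i * ?y ^ j) - (if i + j = m then fps_const (c ^ j) * z else 0)) (\<epsilon> / 2)"
    proof (cases "i + j = m")
      case True
      have "l1_le q (fps_const (c ^ j) * (z' - z)) (cmod (c ^ j) * min e (\<epsilon> / 2))"
        by (rule l1_le_const_mult[OF z'])
      moreover have "cmod (c ^ j) * min e (\<epsilon> / 2) \<le> 1 * (\<epsilon> / 2)"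
        using c \<open>0 < e\<close> \<open>0 < \<epsilon>\<close> by (intro mult_mono) (auto simp: norm_power power_le_one)
      ultimately have "l1_le q (fps_const (c ^ j) * (z' - z)) (\<epsilon> / 2)" by (auto intro: l1_le_mono)
      then show ?thesis using main[OF ij] True by (simp add: right_diff_distrib)
    next
      case False
      then show ?thesis using main[OF ij] \<open>0 < \<epsilon>\<close> by simp
    qed
    show "l1_le q (shift_pow N ((?x + s) ^ i * (?y + s') ^ j) - (if i + j = m then fps_const (c ^ j) * z else 0)) \<epsilon>"
      using l1_le_add[OF 1 2] by simp
  qed
  moreover have "l1_le r u e" using u(2) by (rule l1_le_mono) simp
  ultimately show ?thesis using u(1,3) \<open>0 < \<eta>\<close> by blast
qed

text \<open>The recursion carries a pair of polynomials together with a seminorm index and a radius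
  within which the latest approximation is stable. Halving the radius and never lowering the index
  keeps the sum of all later corrections inside every earlier ball, so the limits inherit all
  approximations.\<close>

lemma exists_approximating_pair:
  fixes m :: "nat \<Rightarrow> nat" and c :: "nat \<Rightarrow> complex" and z :: "nat \<Rightarrow> complex fps"
  assumes m: "\<And>n. 1 \<le> m n" and c: "\<And>n. cmod (c n) \<le> 1" and z: "\<And>n. \<exists>d. degree_le (z n) d"
  shows "\<exists>x y. (\<forall>q. \<exists>b. l1_le q x b) \<and> (\<forall>q. \<exists>b. l1_le q y b) \<and>
    (\<forall>n. \<exists>N. shift_approximates N n (m n) (c n) (z n) (1 / 2 ^ n) x y)"
proof -
  define P where "P n s = (case s of (x, y, t, \<eta>) \<Rightarrow> (\<exists>d. degree_le x d \<and> degree_le y d) \<and> 0 < \<eta>)"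
    for n :: nat and s :: "complex fps \<times> complex fps \<times> nat \<times> real"
  \<comment> \<open>The clause \<open>max t n \<le> t'\<close> makes the indices exhaust all
    seminorms. The vanishing coefficients of \<open>u\<close> make every coefficient of the two
    sequences eventually constant, so the limits can be written down coefficientwise.\<close>
  define Q where "Q n s s' = (case s of (x, y, t, \<eta>) \<Rightarrow> case s' of (x', y', t', \<eta>') \<Rightarrow> \<exists>u. x' = x + u \<and> y' = y + fps_const (c n) * u \<and>
      l1_le t u (\<eta> / 2) \<and> (\<forall>i<n. u $ i = 0) \<and> max t n \<le> t' \<and> \<eta>' \<le> \<eta> / 2 \<and>
      (\<exists>N. \<forall>s s'. l1_le t' s \<eta>' \<longrightarrow> l1_le t' s' \<eta>' \<longrightarrow> shift_approximates N n (m n) (c n) (z n) (1 / 2 ^ n) (x' + s) (y' + s')))"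
    for n :: nat and s s' :: "complex fps \<times> complex fps \<times> nat \<times> real"
  have "\<exists>f. \<forall>n. P n (f n) \<and> Q n (f n) (f (Suc n))"
  proof (rule dependent_nat_choice)
    show "\<exists>s. P 0 s" by (rule exI[of _ "(0, 0, 0, 1)"]) (auto simp: P_def intro: degree_le_0)
  next
    fix s n assume "P n s"
    then obtain x y t \<eta> D where s: "s = (x, y, t, \<eta>)" and D: "degree_le x D" "degree_le y D" and "0 < \<eta>"
      by (auto simp: P_def)
    obtain M where M: "degree_le (z n) M" using z by blast
    have pos: "0 < \<eta> / 2" "0 < (1 / 2 ^ n :: real)" using \<open>0 < \<eta>\<close> by simp_all
    obtain u d N t' \<eta>' where u: "degree_le u d" "l1_le t u (\<eta> / 2)" "\<forall>i<n. u $ i = 0" "0 < \<eta>'"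
      and app: "\<And>s s'. l1_le t' s \<eta>' \<Longrightarrow> l1_le t' s' \<eta>' \<Longrightarrow>
        shift_approximates N n (m n) (c n) (z n) (1 / 2 ^ n) (x + u + s) (y + fps_const (c n) * u + s')"
      using robust_perturbation[OF D M m[of n] c[of n] pos, of t n n] by blast
    let ?t = "max t' (max t n)" and ?\<eta> = "min \<eta>' (\<eta> / 2)"
    let ?s = "(x + u, y + fps_const (c n) * u, ?t, ?\<eta>)"
    have "P (Suc n) ?s"
      unfolding P_def using u(4) \<open>0 < \<eta>\<close>
      by (auto intro!: exI[of _ "max D d"] degree_le_add degree_le_const_mult
          degree_le_mono[OF D(1)] degree_le_mono[OF D(2)] degree_le_mono[OF u(1)])
    moreover have "shift_approximates N n (m n) (c n) (z n) (1 / 2 ^ n) (x + u + s) (y + fps_const (c n) * u + s')"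
      if "l1_le ?t s ?\<eta>" "l1_le ?t s' ?\<eta>" for s s'
      by (rule app; rule l1_le_mono[OF l1_le_antimono]; (rule that)?; simp)
    then have "Q n s ?s" unfolding Q_def s using u by auto
    ultimately show "\<exists>s'. P (Suc n) s' \<and> Q n s s'" by blast
  qed
  then obtain f where f: "\<And>n. P n (f n)" "\<And>n. Q n (f n) (f (Suc n))" by blast
  define X Y T H where "X n = fst (f n)" and "Y n = fst (snd (f n))"
    and "T n = fst (snd (snd (f n)))" and "H n = snd (snd (snd (f n)))" for n
  have f_eq: "f n = (X n, Y n, T n, H n)" for n by (simp add: X_def Y_def T_def H_def)
  have H: "0 < H n" and fin: "\<exists>d. degree_le (X n) d \<and> degree_le (Y n) d" for n
    using f(1)[of n] by (auto simp: P_def f_eq)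
  have step: "\<exists>u. X (Suc n) = X n + u \<and> Y (Suc n) = Y n + fps_const (c n) * u \<and>
      l1_le (T n) u (H n / 2) \<and> (\<forall>i<n. u $ i = 0) \<and> max (T n) n \<le> T (Suc n) \<and> H (Suc n) \<le> H n / 2 \<and>
      (\<exists>N. \<forall>s s'. l1_le (T (Suc n)) s (H (Suc n)) \<longrightarrow> l1_le (T (Suc n)) s' (H (Suc n)) \<longrightarrow>
        shift_approximates N n (m n) (c n) (z n) (1 / 2 ^ n) (X (Suc n) + s) (Y (Suc n) + s'))" for n
    using f(2)[of n] unfolding Q_def f_eq prod.case .
  then have "\<forall>n. \<exists>u. X (Suc n) = X n + u \<and> Y (Suc n) = Y n + fps_const (c n) * u \<and>
      l1_le (T n) u (H n / 2) \<and> (\<forall>i<n. u $ i = 0)"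
    by meson
  then obtain U where U: "\<And>n. X (Suc n) = X n + U n" "\<And>n. Y (Suc n) = Y n + fps_const (c n) * U n"
      "\<And>n. l1_le (T n) (U n) (H n / 2)" "\<And>n i. i < n \<Longrightarrow> U n $ i = 0" by metis
  have T: "max (T n) n \<le> T (Suc n)" and H': "H (Suc n) \<le> H n / 2" for n
    using step[of n] by blast+
  have app: "\<exists>N. \<forall>s s'. l1_le (T (Suc n)) s (H (Suc n)) \<longrightarrow> l1_le (T (Suc n)) s' (H (Suc n)) \<longrightarrow>
     shift_approximates N n (m n) (c n) (z n) (1 / 2 ^ n) (X (Suc n) + s) (Y (Suc n) + s')" for n
    using step[of n] by blast
  have T_mono: "i \<le> j \<Longrightarrow> T i \<le> T j" for i j
    by (rule lift_Suc_mono_le[of T]) (use T in auto)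
  have limit: "\<exists>x. \<forall>j. l1_le (T j) (x - Z j) (H j)"
    if Z: "\<And>n. Z (Suc n) = Z n + V n" "\<And>n. l1_le (T n) (V n) (H n / 2)" "\<And>n i. i < n \<Longrightarrow> V n $ i = 0"
    for Z V :: "nat \<Rightarrow> complex fps"
  proof -
    define x where "x = Abs_fps (\<lambda>n. Z (Suc n) $ n)"
    have stable: "Z J $ n = x $ n" if "n < J" for n J
      using that
    proof (induction J)
      case (Suc J)
      then show ?case by (cases "n = J") (auto simp: Z x_def)
    qed simp
    \<comment> \<open>The subtracted \<open>H J\<close> pays for the next correction, since
      \<open>H J / 2 \<le> H J - H (Suc J)\<close>.\<close>
    have tail: "l1_le (T j) (Z J - Z j) (H j - H J)" if "j \<le> J" for j J
      using that
    proof (induction J rule: dec_induct)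
      case (step J)
      have "l1_le (T j) (V J) (H J / 2)"
        using l1_le_antimono[OF Z(2)[of J] T_mono[OF step(1)]] .
      from l1_le_add[OF step(3) this] have "l1_le (T j) (Z J - Z j + V J) (H j - H J / 2)" by simp
      then show ?case by (rule l1_le_mono[of _ _ _ _, THEN back_subst[of "\<lambda>f. l1_le _ f _"]])
          (use H'[of J] in \<open>auto simp: Z\<close>)
    qed simp
    have "l1_le (T j) (x - Z j) (H j)" for j
      unfolding l1_le_def
    proof
      fix L
      let ?J = "max L j"
      have "(\<Sum>n<L. cmod ((x - Z j) $ n) * a (T j) n) = (\<Sum>n<L. cmod ((Z ?J - Z j) $ n) * a (T j) n)"
        by (intro sum.cong refl) (simp add: stable)
      also have "\<dots> \<le> H j - H ?J" using tail[of j ?J] by (simp add: l1_le_def)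
      also have "\<dots> \<le> H j" using H[of ?J] by simp
      finally show "(\<Sum>n<L. cmod ((x - Z j) $ n) * a (T j) n) \<le> H j" .
    qed
    then show ?thesis by blast
  qed
  have "l1_le (T n) (fps_const (c n) * U n) (H n / 2)" for n
    using l1_le_mono[OF l1_le_const_mult[OF U(3)[of n], of "c n"], of "H n / 2"] c[of n] H[of n]
    by (simp add: mult_left_le_one_le)
  from limit[of Y, OF U(2) this] obtain y where y: "\<And>j. l1_le (T j) (y - Y j) (H j)"
    using U(4) by auto
  from limit[of X, OF U(1) U(3) U(4)] obtain x where x: "\<And>j. l1_le (T j) (x - X j) (H j)"
    by auto
  have finite_l1_le: "\<exists>b. l1_le q v b" if v: "\<And>j. l1_le (T j) (v - Z j) (H j)" and Z: "\<And>j. \<exists>d. degree_le (Z j) d" for q v Z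
  proof -
    obtain d where "degree_le (Z (Suc q)) d" using Z by blast
    from degree_le_imp_l1_le[OF this] obtain b where "l1_le q (Z (Suc q)) b" by blast
    moreover have "l1_le q (v - Z (Suc q)) (H (Suc q))"
      by (rule l1_le_antimono[OF v]) (use T[of q] in simp)
    ultimately have "l1_le q (Z (Suc q) + (v - Z (Suc q))) (b + H (Suc q))" by (rule l1_le_add)
    then show ?thesis by auto
  qed
  have "\<exists>N. shift_approximates N n (m n) (c n) (z n) (1 / 2 ^ n) x y" for n
  proof -
    obtain N where "shift_approximates N n (m n) (c n) (z n) (1 / 2 ^ n) (X (Suc n) + (x - X (Suc n))) (Y (Suc n) + (y - Y (Suc n)))"
      using app[of n] x y by blast
    then show ?thesis by auto
  qed
  then show ?thesis using finite_l1_le[of x X] finite_l1_le[of y Y] x y fin by blast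
qed

end

text \<open>Polynomials with Gaussian rational coefficients, coded by lists over a countable type so
  that \<open>from_nat\<close> enumerates these targets.\<close>

definition rat_fps :: "(rat \<times> rat) list \<Rightarrow> complex fps" where
  "rat_fps l = (\<Sum>i<length l. fps_const (Complex (of_rat (fst (l ! i))) (of_rat (snd (l ! i)))) * fps_X ^ i)"

lemma degree_le_rat_fps: "degree_le (rat_fps l) (length l)"
  unfolding rat_fps_def by (intro degree_le_sum degree_le_mono[OF degree_le_monom]) auto

lemma complex_rat_approx:
  assumes "0 < \<epsilon>"
  shows "\<exists>r s. cmod (Complex (of_rat r) (of_rat s) - b) \<le> \<epsilon>"
proof -
  obtain r where r: "Re b < of_rat r" "of_rat r < Re b + \<epsilon> / 2"
    using of_rat_dense[of "Re b" "Re b + \<epsilon> / 2"] assms by auto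
  obtain s where s: "Im b < of_rat s" "of_rat s < Im b + \<epsilon> / 2"
    using of_rat_dense[of "Im b" "Im b + \<epsilon> / 2"] assms by auto
  have "cmod (Complex (of_rat r) (of_rat s) - b) \<le> \<bar>of_rat r - Re b\<bar> + \<bar>of_rat s - Im b\<bar>"
    using cmod_le[of "Complex (of_rat r) (of_rat s) - b"] by simp
  also have "\<dots> \<le> \<epsilon>" using r s by linarith
  finally show ?thesis by blast
qed

text \<open>In total degree \<open>m\<close> the second exponent determines the first, so the top
  part is a nonzero polynomial in one variable with finitely many roots. The candidates
  \<open>1 / (b + 1)\<close> are infinitely many and have modulus at most 1, as
  \<open>robust_perturbation\<close> demands.\<close>

lemma exists_nonroot:
  fixes \<alpha> :: "nat \<times> nat \<Rightarrow> complex"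
  assumes F: "finite F" and ij: "(i, j) \<in> F" "i + j = m" "\<alpha> (i, j) \<noteq> 0"
  shows "\<exists>b. (\<Sum>ij\<in>{ij \<in> F. fst ij + snd ij = m}. \<alpha> ij * (1 / of_nat (Suc b)) ^ snd ij) \<noteq> 0"
proof -
  let ?F = "{ij \<in> F. fst ij + snd ij = m}"
  define p where "p = (\<Sum>ij\<in>?F. monom (\<alpha> ij) (snd ij))"
  have "coeff p j = (\<Sum>ij\<in>?F. if ij = (i, j) then \<alpha> ij else 0)"
    unfolding p_def coeff_sum coeff_monom by (intro sum.cong) (use ij in auto)
  also have "\<dots> = \<alpha> (i, j)" using F ij by simp
  finally have "p \<noteq> 0" using ij by auto
  then have "finite {l. poly p l = 0}" by (rule poly_roots_finite)
  moreover have "infinite (range (\<lambda>b. 1 / of_nat (Suc b) :: complex))"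
  proof (rule range_inj_infinite)
    show "inj (\<lambda>b. 1 / of_nat (Suc b) :: complex)"
      by (rule injI) (simp del: of_nat_Suc)
  qed
  ultimately obtain b where "poly p (1 / of_nat (Suc b)) \<noteq> 0"
    by (metis (mono_tags, lifting) finite_subset image_subsetI mem_Collect_eq)
  then show ?thesis
    by (intro exI[of _ b]) (simp add: p_def poly_sum poly_monom)
qed

context weighted_shift
begin

lemma rat_fps_dense:
  assumes z: "degree_le z M" and "0 < \<epsilon>"
  shows "\<exists>l. l1_le q (rat_fps l - z) \<epsilon>"
proof -
  \<comment> \<open>Each of the \<open>Suc M\<close> coefficients receives an equal share of
    \<open>\<epsilon>\<close>; adding 1 guards against \<open>a q i = 0\<close>.\<close>
  define \<eta> where "\<eta> i = \<epsilon> / (Suc M * (1 + a q i))" for i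
  have "0 < \<eta> i" for i using \<open>0 < \<epsilon>\<close> a_nonneg[of q i] by (simp add: \<eta>_def)
  then have "\<forall>i. \<exists>rs. cmod (Complex (of_rat (fst rs)) (of_rat (snd rs)) - z $ i) \<le> \<eta> i"
    using complex_rat_approx by simp
  then obtain f where f: "\<And>i. cmod (Complex (of_rat (fst (f i))) (of_rat (snd (f i))) - z $ i) \<le> \<eta> i"
    by metis
  define l where "l = map f [0..<Suc M]"
  let ?d = "\<lambda>i. Complex (of_rat (fst (f i))) (of_rat (snd (f i))) - z $ i"
  have z_sum: "z = (\<Sum>i<Suc M. fps_const (z $ i) * fps_X ^ i)"
    unfolding lessThan_Suc_atMost
    using z by (auto simp: fps_eq_iff fps_sum_nth fps_X_power_iff degree_le_def not_le
            if_distrib[of "(*) _"] cong: if_cong)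
  have l_sum: "rat_fps l = (\<Sum>i<Suc M. fps_const (Complex (of_rat (fst (f i))) (of_rat (snd (f i)))) * fps_X ^ i)"
    unfolding rat_fps_def by (rule sum.cong) (auto simp: l_def simp del: upt_Suc)
  have "rat_fps l - z = (\<Sum>i<Suc M. fps_const (Complex (of_rat (fst (f i))) (of_rat (snd (f i)))) * fps_X ^ i)
      - (\<Sum>i<Suc M. fps_const (z $ i) * fps_X ^ i)"
    by (simp only: l_sum z_sum[symmetric])
  also have "\<dots> = (\<Sum>i<Suc M. fps_const (?d i) * fps_X ^ i)"
    unfolding sum_subtractf[symmetric] left_diff_distrib[symmetric] fps_const_sub ..
  finally have "l1_le q (rat_fps l - z) (\<Sum>i<Suc M. cmod (?d i) * a q i)"
    by (simp only:) (intro l1_le_sum l1_le_monom finite_lessThan)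
  moreover have "(\<Sum>i<Suc M. cmod (?d i) * a q i) \<le> (\<Sum>i<Suc M. \<epsilon> / Suc M)"
  proof (rule sum_mono)
    fix i
    have "cmod (?d i) * a q i \<le> \<eta> i * (1 + a q i)"
      using f[of i] a_nonneg[of q i] \<open>0 < \<eta> i\<close> by (intro mult_mono) auto
    also have "\<dots> = \<epsilon> / Suc M" using a_nonneg[of q i] by (simp add: \<eta>_def)
    finally show "cmod (?d i) * a q i \<le> \<epsilon> / Suc M" .
  qed
  then have "(\<Sum>i<Suc M. cmod (?d i) * a q i) \<le> \<epsilon>" by simp
  ultimately show ?thesis by (blast intro: l1_le_mono)
qed

lemma exists_hypercyclic_pair:
  "\<exists>x y. (\<forall>q. \<exists>b. l1_le q x b) \<and> (\<forall>q. \<exists>b. l1_le q y b) \<and>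
    (\<forall>F \<alpha>. finite F \<longrightarrow> (0, 0) \<notin> F \<longrightarrow> (\<exists>ij\<in>F. \<alpha> ij \<noteq> 0) \<longrightarrow>
      (\<forall>z d q. \<forall>\<epsilon>>0. degree_le z d \<longrightarrow>
        (\<exists>N. l1_le q (shift_pow N (\<Sum>ij\<in>F. fps_const (\<alpha> ij) * (x ^ fst ij * y ^ snd ij)) - z) \<epsilon>)))"
proof -
  \<comment> \<open>A task is a degree less one, an index \<open>b\<close> for the scalar
    \<open>1 / (b + 1)\<close>, and a target. Dropping the second component of the decoded pair
    makes every task recur at arbitrarily late stages \<open>n\<close>, where the seminorm
    \<open>n\<close> and the accuracy \<open>1 / 2 ^ n\<close> are good enough.\<close>
  define task :: "nat \<Rightarrow> nat \<times> nat \<times> (rat \<times> rat) list" where "task n = from_nat (fst (prod_decode n))" for n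
  define m where "m n = Suc (fst (task n))" for n
  define c where "c n = (1 / of_nat (Suc (fst (snd (task n)))) :: complex)" for n
  define zz where "zz n = rat_fps (snd (snd (task n)))" for n
  have task_surj: "\<exists>n\<ge>k. task n = t" for k t
  proof (intro exI conjI)
    show "k \<le> prod_encode (to_nat t, k)" by (rule le_prod_encode_2)
    show "task (prod_encode (to_nat t, k)) = t" by (simp add: task_def)
  qed
  have "1 \<le> m n" "cmod (c n) \<le> 1" "\<exists>d. degree_le (zz n) d" for n
    using degree_le_rat_fps by (auto simp: m_def c_def zz_def norm_divide simp del: of_nat_Suc)
  then obtain x y where xy: "\<And>q. \<exists>b. l1_le q x b" "\<And>q. \<exists>b. l1_le q y b"
    and app: "\<And>n. \<exists>N. shift_approximates N n (m n) (c n) (zz n) (1 / 2 ^ n) x y"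
    using exists_approximating_pair[of m c zz] by blast
  have "\<exists>N. l1_le q (shift_pow N (\<Sum>ij\<in>F. fps_const (\<alpha> ij) * (x ^ fst ij * y ^ snd ij)) - z) \<epsilon>"
    if F: "finite F" "(0, 0) \<notin> F" and nz: "\<exists>ij\<in>F. \<alpha> ij \<noteq> 0" and z: "degree_le z d" and "0 < \<epsilon>"
    for F \<alpha> z d q \<epsilon>
  proof -
    \<comment> \<open>Without zero coefficients, the maximal total degree \<open>k\<close> is
      attained by a term that really occurs; \<open>k\<close> is positive because
      \<open>(0, 0)\<close> is excluded.\<close>
    define F' where "F' = {ij\<in>F. \<alpha> ij \<noteq> 0}"
    have F': "finite F'" "F' \<noteq> {}" using F nz by (auto simp: F'_def)
    define k where "k = Max ((\<lambda>ij. fst ij + snd ij) ` F')"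
    have le_k: "fst ij + snd ij \<le> k" if "ij \<in> F'" for ij
      unfolding k_def using F' that by (intro Max_ge) auto
    have "k \<in> (\<lambda>ij. fst ij + snd ij) ` F'" unfolding k_def using F' by (intro Max_in) auto
    then obtain i j where ij: "(i, j) \<in> F'" "i + j = k" by auto
    then have "(i, j) \<in> F" and \<alpha>: "\<alpha> (i, j) \<noteq> 0" by (simp_all add: F'_def)
    then have "k \<noteq> 0" using F(2) ij(2) by (metis add_is_0)
    obtain b where b: "(\<Sum>ij\<in>{ij \<in> F'. fst ij + snd ij = k}. \<alpha> ij * (1 / of_nat (Suc b)) ^ snd ij) \<noteq> 0"
      using exists_nonroot[of F' i j k \<alpha>, OF F'(1) ij \<alpha>] by blast
    define Q where "Q = (\<Sum>ij\<in>{ij \<in> F'. fst ij + snd ij = k}. \<alpha> ij * (1 / of_nat (Suc b)) ^ snd ij)"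
    have "Q \<noteq> 0" using b by (simp add: Q_def)
    \<comment> \<open>The shift will bring the polynomial close to \<open>Q\<close> times the coded
      target, so the target has to approximate \<open>z / Q\<close>.\<close>
    have "degree_le (fps_const (1 / Q) * z) d" using z by (rule degree_le_const_mult)
    moreover have "0 < \<epsilon> / 2 / cmod Q" using \<open>0 < \<epsilon>\<close> \<open>Q \<noteq> 0\<close> by simp
    ultimately obtain l where l: "l1_le q (rat_fps l - fps_const (1 / Q) * z) (\<epsilon> / 2 / cmod Q)"
      using rat_fps_dense by blast
    define S where "S = (\<Sum>ij\<in>F'. cmod (\<alpha> ij))"
    have "(\<lambda>n. S * (1 / 2) ^ n) \<longlonglongrightarrow> 0"
      by (intro tendsto_mult_right_zero LIMSEQ_power_zero) simp
    then have "\<forall>\<^sub>F n in sequentially. S * (1 / 2) ^ n < \<epsilon> / 2"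
      by (rule order_tendstoD) (use \<open>0 < \<epsilon>\<close> in simp)
    then obtain K where K: "\<And>n. K \<le> n \<Longrightarrow> S * (1 / 2) ^ n < \<epsilon> / 2"
      by (auto simp: eventually_sequentially)
    obtain n where n: "max K q \<le> n" "task n = (k - 1, b, l)" using task_surj by blast
    have mn: "m n = k" "c n = 1 / of_nat (Suc b)" "zz n = rat_fps l"
      using n(2) \<open>k \<noteq> 0\<close> by (simp_all add: m_def c_def zz_def)
    obtain N where "shift_approximates N n (m n) (c n) (zz n) (1 / 2 ^ n) x y" using app by blast
    then have app_N: "\<And>i j. i + j \<le> k \<Longrightarrow> l1_le n (shift_pow N (x ^ i * y ^ j)
        - (if i + j = k then fps_const (c n ^ j) * rat_fps l else 0)) (1 / 2 ^ n)"
      unfolding shift_approximates_def mn(1,3) by blast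
    have N: "l1_le q (shift_pow N (x ^ fst ij * y ^ snd ij)
        - (if fst ij + snd ij = k then fps_const (c n ^ snd ij) * rat_fps l else 0)) (1 / 2 ^ n)"
      if "ij \<in> F'" for ij
      by (rule l1_le_antimono[OF app_N[OF le_k[OF that]]]) (use n(1) in simp)
    let ?g = "\<Sum>ij\<in>F. fps_const (\<alpha> ij) * (x ^ fst ij * y ^ snd ij)"
    have g: "?g = (\<Sum>ij\<in>F'. fps_const (\<alpha> ij) * (x ^ fst ij * y ^ snd ij))"
      by (rule sum.mono_neutral_right) (use F in \<open>auto simp: F'_def\<close>)
    have "fps_const Q * rat_fps l = (\<Sum>ij\<in>{ij \<in> F'. fst ij + snd ij = k}. fps_const (\<alpha> ij) * (fps_const (c n ^ snd ij) * rat_fps l))"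
      unfolding Q_def mn(2) by (simp add: fps_eq_iff fps_sum_nth sum_distrib_right mult.assoc)
    also have "\<dots> = (\<Sum>ij\<in>F'. fps_const (\<alpha> ij) * (if fst ij + snd ij = k then fps_const (c n ^ snd ij) * rat_fps l else 0))"
      by (rule sum.mono_neutral_cong_left) (use F' in auto)
    finally have Ql: "fps_const Q * rat_fps l = \<dots>" .
    have "l1_le q (\<Sum>ij\<in>F'. fps_const (\<alpha> ij) * (shift_pow N (x ^ fst ij * y ^ snd ij)
        - (if fst ij + snd ij = k then fps_const (c n ^ snd ij) * rat_fps l else 0)))
        (\<Sum>ij\<in>F'. cmod (\<alpha> ij) * (1 / 2 ^ n))"
      by (intro l1_le_sum l1_le_const_mult N F'(1))
    also have "(\<Sum>ij\<in>F'. fps_const (\<alpha> ij) * (shift_pow N (x ^ fst ij * y ^ snd ij)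
        - (if fst ij + snd ij = k then fps_const (c n ^ snd ij) * rat_fps l else 0)))
        = shift_pow N ?g - fps_const Q * rat_fps l"
      unfolding Ql g by (simp add: shift_pow_sum shift_pow_const_mult right_diff_distrib sum_subtractf)
    finally have "l1_le q (shift_pow N ?g - fps_const Q * rat_fps l) (S * (1 / 2) ^ n)"
      by (simp add: S_def sum_divide_distrib power_one_over)
    then have 1: "l1_le q (shift_pow N ?g - fps_const Q * rat_fps l) (\<epsilon> / 2)"
      by (rule l1_le_mono) (use K[of n] n(1) in simp)
    have "l1_le q (fps_const Q * (rat_fps l - fps_const (1 / Q) * z)) (cmod Q * (\<epsilon> / 2 / cmod Q))"
      by (rule l1_le_const_mult[OF l])
    moreover have "fps_const Q * (rat_fps l - fps_const (1 / Q) * z) = fps_const Q * rat_fps l - z"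
      using \<open>Q \<noteq> 0\<close> by (simp add: fps_eq_iff right_diff_distrib)
    ultimately have 2: "l1_le q (fps_const Q * rat_fps l - z) (\<epsilon> / 2)" using \<open>Q \<noteq> 0\<close> by simp
    from l1_le_add[OF 1 2] show ?thesis by (intro exI[of _ N]) simp
  qed
  then show ?thesis using xy by blast
qed

end

subsection \<open>Frechet sequence spaces with basis\<close>

lemma sum_fun_nth: "sum f I k = (\<Sum>i\<in>I. f i k)" for f :: "'b \<Rightarrow> 'a \<Rightarrow> 'c::comm_monoid_add"
  by (induction I rule: infinite_finite_induct) auto

locale frechet_sequences =
  fixes X :: "cseq set" and p :: "nat \<Rightarrow> cseq \<Rightarrow> real"
  assumes fsa: "frechet_sequence_algebra X p"
begin

lemma subspace: "seq.subspace X"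
  and seminorm: "1 \<le> q \<Longrightarrow> seminorm_on X (p q)"
  and p_mono: "1 \<le> q \<Longrightarrow> q \<le> r \<Longrightarrow> x \<in> X \<Longrightarrow> p q x \<le> p r x"
  and complete: "range s \<subseteq> X \<Longrightarrow> seminorm_Cauchy p s \<Longrightarrow> \<exists>l. limitin (seminorm_topology X p) s l sequentially"
  and p_submult: "1 \<le> q \<Longrightarrow> x \<in> X \<Longrightarrow> y \<in> X \<Longrightarrow> p q (cauchy_prod x y) \<le> p q x * p q y"
  and embedding: "continuous_map (seminorm_topology X p) euclidean (\<lambda>x. x)"
  using fsa unfolding frechet_sequence_algebra_def frechet_space_def by auto

lemma p_nonneg: "1 \<le> q \<Longrightarrow> x \<in> X \<Longrightarrow> 0 \<le> p q x"
  and p_triangle: "1 \<le> q \<Longrightarrow> x \<in> X \<Longrightarrow> y \<in> X \<Longrightarrow> p q (x + y) \<le> p q x + p q y"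
  and p_scale: "1 \<le> q \<Longrightarrow> x \<in> X \<Longrightarrow> p q (scale_seq c x) = cmod c * p q x"
  using seminorm[of q] by (auto simp: seminorm_on_def)

lemmas X_add = seq.subspace_add[OF subspace]
  and X_diff = seq.subspace_diff[OF subspace]
  and X_scale = seq.subspace_scale[OF subspace]
  and X_zero = seq.subspace_0[OF subspace]
  and X_sum = seq.subspace_sum[OF subspace]

lemma p_zero: "1 \<le> q \<Longrightarrow> p q 0 = 0"
  using p_scale[of q 0 0] X_zero by simp

lemma p_minus_commute: "1 \<le> q \<Longrightarrow> x \<in> X \<Longrightarrow> y \<in> X \<Longrightarrow> p q (x - y) = p q (y - x)"
  using p_scale[of q "y - x" "-1"] X_diff[of y x] by simp

lemma p_diff_triangle:
  assumes "1 \<le> q" "x \<in> X" "y \<in> X" "z \<in> X"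
  shows "p q (x - z) \<le> p q (x - y) + p q (y - z)"
  using p_triangle[of q "x - y" "y - z"] assms X_diff by simp

lemma p_sum:
  assumes "1 \<le> q" "\<And>i. i \<in> I \<Longrightarrow> v i \<in> X"
  shows "p q (sum v I) \<le> (\<Sum>i\<in>I. p q (v i))"
  using assms(2)
proof (induction I rule: infinite_finite_induct)
  case (insert i I)
  have "v i \<in> X" "sum v I \<in> X" using insert.prems by (auto intro: X_sum)
  then have "p q (v i + sum v I) \<le> p q (v i) + p q (sum v I)"
    by (rule p_triangle[OF assms(1)])
  also have "\<dots> \<le> p q (v i) + (\<Sum>i\<in>I. p q (v i))" using insert by auto
  finally show ?case unfolding sum.insert[OF insert.hyps] .
qed (use p_zero assms(1) in auto)

lemma openin_ball_at:
  assumes "x \<in> X" "1 \<le> q" "0 < \<epsilon>"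
  shows "openin (seminorm_topology X p) {y \<in> X. p q (y - x) < \<epsilon>}"
  unfolding seminorm_topology_def
  by (rule topology_generated_by_Basis, rule CollectI, intro exI conjI, rule refl) (rule assms)+

lemma topspace_seminorm_topology: "topspace (seminorm_topology X p) = X"
proof
  show "topspace (seminorm_topology X p) \<subseteq> X"
    unfolding seminorm_topology_def topology_generated_by_topspace by blast
  show "X \<subseteq> topspace (seminorm_topology X p)"
  proof
    fix x assume "x \<in> X"
    then have "x \<in> {y \<in> X. p 1 (y - x) < 1}" using p_zero by simp
    moreover have "{y \<in> X. p 1 (y - x) < 1} \<subseteq> topspace (seminorm_topology X p)"
      by (intro openin_subset openin_ball_at \<open>x \<in> X\<close>) simp_all
    ultimately show "x \<in> topspace (seminorm_topology X p)" by (rule rev_subsetD)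
  qed
qed

text \<open>By definition the balls are only a subbase. They form a base because the seminorms
  increase: a ball for \<open>max q r\<close> with the smaller radius lies in both given
  balls.\<close>

lemma openin_seminorm_topology:
  "openin (seminorm_topology X p) U \<longleftrightarrow>
    U \<subseteq> X \<and> (\<forall>x\<in>U. \<exists>q\<ge>1. \<exists>\<epsilon>>0. {y \<in> X. p q (y - x) < \<epsilon>} \<subseteq> U)"
proof
  assume "openin (seminorm_topology X p) U"
  then have "generate_topology_on {{y \<in> X. p q (y - x) < \<epsilon>} | x q \<epsilon>. x \<in> X \<and> 1 \<le> q \<and> 0 < \<epsilon>} U"
    unfolding seminorm_topology_def by (rule openin_topology_generated_by)
  then show "U \<subseteq> X \<and> (\<forall>x\<in>U. \<exists>q\<ge>1. \<exists>\<epsilon>>0. {y \<in> X. p q (y - x) < \<epsilon>} \<subseteq> U)"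
  proof induction
    case (Int U V)
    have "\<exists>q\<ge>1. \<exists>\<epsilon>>0. {y \<in> X. p q (y - x) < \<epsilon>} \<subseteq> U \<inter> V" if x: "x \<in> U \<inter> V" for x
    proof -
      obtain q \<epsilon> where q: "1 \<le> q" "0 < \<epsilon>" "{y \<in> X. p q (y - x) < \<epsilon>} \<subseteq> U"
        using Int.IH x by blast
      obtain r \<delta> where r: "1 \<le> r" "0 < \<delta>" "{y \<in> X. p r (y - x) < \<delta>} \<subseteq> V"
        using Int.IH x by blast
      have "x \<in> X" using Int.IH x by blast
      have "{y \<in> X. p (max q r) (y - x) < min \<epsilon> \<delta>} \<subseteq> U \<inter> V"
      proof
        fix y assume y: "y \<in> {y \<in> X. p (max q r) (y - x) < min \<epsilon> \<delta>}"
        then have "y - x \<in> X" using X_diff \<open>x \<in> X\<close> by simp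
        then have "p q (y - x) \<le> p (max q r) (y - x)" "p r (y - x) \<le> p (max q r) (y - x)"
          using p_mono q(1) r(1) by simp_all
        then show "y \<in> U \<inter> V" using y q(3) r(3) by auto
      qed
      then show ?thesis using q r by (intro exI[of _ "max q r"] conjI exI[of _ "min \<epsilon> \<delta>"]) auto
    qed
    moreover have "U \<inter> V \<subseteq> X" using Int.IH by blast
    ultimately show ?case by (intro conjI ballI)
  next
    case (UN K)
    have "\<exists>q\<ge>1. \<exists>\<epsilon>>0. {y \<in> X. p q (y - x) < \<epsilon>} \<subseteq> \<Union> K" if "x \<in> \<Union> K" for x
    proof -
      from that obtain U where "U \<in> K" "x \<in> U" by blast
      with UN.IH obtain q \<epsilon> where "1 \<le> q" "0 < \<epsilon>" "{y \<in> X. p q (y - x) < \<epsilon>} \<subseteq> U" by blast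
      with \<open>U \<in> K\<close> show ?thesis by blast
    qed
    moreover have "\<Union> K \<subseteq> X" using UN.IH by blast
    ultimately show ?case by (intro conjI ballI)
  next
    case (Basis U)
    then obtain x q \<epsilon> where U: "U = {y \<in> X. p q (y - x) < \<epsilon>}" "x \<in> X" "1 \<le> q" by blast
    have "{z \<in> X. p q (z - y) < \<epsilon> - p q (y - x)} \<subseteq> U" if "y \<in> U" for y
    proof
      fix z assume z: "z \<in> {z \<in> X. p q (z - y) < \<epsilon> - p q (y - x)}"
      have "p q (z - x) \<le> p q (z - y) + p q (y - x)"
        by (rule p_diff_triangle) (use U that z in auto)
      then show "z \<in> U" using z U by simp
    qed
    moreover have "0 < \<epsilon> - p q (y - x)" if "y \<in> U" for y using that U by simp
    ultimately have "\<exists>q\<ge>1. \<exists>\<epsilon>>0. {z \<in> X. p q (z - y) < \<epsilon>} \<subseteq> U" if "y \<in> U" for y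
      using that U(3) by meson
    moreover have "U \<subseteq> X" using U(1) by blast
    ultimately show ?case by (intro conjI ballI)
  qed simp
next
  assume U: "U \<subseteq> X \<and> (\<forall>x\<in>U. \<exists>q\<ge>1. \<exists>\<epsilon>>0. {y \<in> X. p q (y - x) < \<epsilon>} \<subseteq> U)"
  have "\<exists>T. openin (seminorm_topology X p) T \<and> x \<in> T \<and> T \<subseteq> U" if x: "x \<in> U" for x
  proof -
    obtain q \<epsilon> where q: "1 \<le> q" "0 < \<epsilon>" "{y \<in> X. p q (y - x) < \<epsilon>} \<subseteq> U" using U x by blast
    have "openin (seminorm_topology X p) {y \<in> X. p q (y - x) < \<epsilon>}"
      using q U x by (intro openin_ball_at) auto
    moreover have "x \<in> {y \<in> X. p q (y - x) < \<epsilon>}" using q U x p_zero by auto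
    ultimately show ?thesis using q(3) by blast
  qed
  then show "openin (seminorm_topology X p) U" by (intro iffD2[OF openin_subopen] ballI)
qed

lemma openin_ball: "1 \<le> q \<Longrightarrow> openin (seminorm_topology X p) {x \<in> X. p q x < \<epsilon>}"
proof -
  assume q: "1 \<le> q"
  have "{z \<in> X. p q (z - y) < \<epsilon> - p q y} \<subseteq> {x \<in> X. p q x < \<epsilon>}" if "y \<in> X" for y
  proof
    fix z assume z: "z \<in> {z \<in> X. p q (z - y) < \<epsilon> - p q y}"
    then have "p q (z - 0) \<le> p q (z - y) + p q (y - 0)"
      by (intro p_diff_triangle) (use q that X_zero in auto)
    then show "z \<in> {x \<in> X. p q x < \<epsilon>}" using z by simp
  qed
  moreover have "0 < \<epsilon> - p q y" if "p q y < \<epsilon>" for y using that by simp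
  ultimately have "\<exists>q\<ge>1. \<exists>\<delta>>0. {z \<in> X. p q (z - y) < \<delta>} \<subseteq> {x \<in> X. p q' x < \<epsilon>}"
    if "y \<in> X" "p q' y < \<epsilon>" "q' = q" for y q'
    using that q by (intro exI[of _ q] conjI exI[of _ "\<epsilon> - p q y"]) auto
  then show ?thesis unfolding openin_seminorm_topology by blast
qed

lemma limitin_seminorm:
  assumes "limitin (seminorm_topology X p) s l sequentially"
  shows "l \<in> X" "1 \<le> q \<Longrightarrow> range s \<subseteq> X \<Longrightarrow> (\<lambda>n. p q (s n - l)) \<longlonglongrightarrow> 0"
proof -
  show l: "l \<in> X" using assms by (simp add: limitin_def topspace_seminorm_topology)
  assume q: "1 \<le> q" and s: "range s \<subseteq> X"
  have "\<forall>\<^sub>F n in sequentially. p q (s n - l) < \<epsilon>" if "0 < \<epsilon>" for \<epsilon>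
  proof -
    have "openin (seminorm_topology X p) {y \<in> X. p q (y - l) < \<epsilon>}"
      using q l that by (intro openin_ball_at)
    moreover have "l \<in> {y \<in> X. p q (y - l) < \<epsilon>}" using q l that p_zero by simp
    ultimately have "\<forall>\<^sub>F n in sequentially. s n \<in> {y \<in> X. p q (y - l) < \<epsilon>}"
      using assms unfolding limitin_def by blast
    then show ?thesis by eventually_elim simp
  qed
  moreover have "0 \<le> p q (s n - l)" for n using q s l X_diff p_nonneg by blast
  ultimately show "(\<lambda>n. p q (s n - l)) \<longlonglongrightarrow> 0" by (simp add: tendsto_iff)
qed

lemma openin_coordinate:
  assumes "open S"
  shows "openin (seminorm_topology X p) {x \<in> X. x n \<in> S}"
proof -
  have "open ((\<lambda>x :: cseq. x n) -` S)"
    by (rule open_vimage[OF assms continuous_on_product_coordinates])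
  then have "openin (seminorm_topology X p) {x \<in> topspace (seminorm_topology X p). x \<in> (\<lambda>x. x n) -` S}"
    using embedding by (auto simp: continuous_map_def)
  then show ?thesis by (simp add: topspace_seminorm_topology)
qed

lemma coordinate_small:
  assumes "0 < \<epsilon>"
  shows "\<exists>q\<ge>1. \<exists>\<delta>>0. \<forall>x\<in>X. p q x < \<delta> \<longrightarrow> cmod (x n) < \<epsilon>"
proof -
  have "openin (seminorm_topology X p) {x \<in> X. x n \<in> ball 0 \<epsilon>}" by (rule openin_coordinate) simp
  moreover have "0 \<in> {x \<in> X. x n \<in> ball 0 \<epsilon>}" using X_zero assms by simp
  ultimately obtain q \<delta> where "1 \<le> q" "0 < \<delta>" "{y \<in> X. p q (y - 0) < \<delta>} \<subseteq> {x \<in> X. x n \<in> ball 0 \<epsilon>}"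
    unfolding openin_seminorm_topology by blast
  then show ?thesis by (intro exI[of _ q] conjI exI[of _ \<delta>]) auto
qed

lemma coordinate_limit:
  assumes "range s \<subseteq> X" "l \<in> X" "\<And>q. 1 \<le> q \<Longrightarrow> (\<lambda>n. p q (s n - l)) \<longlonglongrightarrow> 0"
  shows "(\<lambda>n. s n k) \<longlonglongrightarrow> l k"
proof (rule tendstoI)
  fix \<epsilon> :: real assume "0 < \<epsilon>"
  then obtain q \<delta> where q: "1 \<le> q" "0 < \<delta>" "\<forall>x\<in>X. p q x < \<delta> \<longrightarrow> cmod (x k) < \<epsilon>"
    using coordinate_small by blast
  have "\<forall>\<^sub>F n in sequentially. p q (s n - l) < \<delta>"
    by (rule order_tendstoD[OF assms(3)]) (use q in auto)
  then show "\<forall>\<^sub>F n in sequentially. dist (s n k) (l k) < \<epsilon>"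
  proof eventually_elim
    case (elim n)
    have "s n - l \<in> X" using assms X_diff by blast
    then show ?case using q(3) elim by (force simp: dist_norm)
  qed
qed

text \<open>Completeness of \<open>X\<close> enters here. The coordinatewise limit serves to
  identify the abstract sum with a concrete sequence.\<close>

lemma series_converges:
  assumes v: "\<And>j. v j \<in> X" and sm: "\<And>q. 1 \<le> q \<Longrightarrow> summable (\<lambda>j. p q (v j))"
  shows "\<exists>x\<in>X. (\<forall>q\<ge>1. (\<lambda>J. p q ((\<Sum>j<J. v j) - x)) \<longlonglongrightarrow> 0) \<and>
    (\<forall>k. (\<lambda>J. \<Sum>j<J. v j k) \<longlonglongrightarrow> x k)"
proof -
  let ?s = "\<lambda>J. \<Sum>j<J. v j"
  have sX: "?s J \<in> X" for J by (rule X_sum) (rule v)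
  then have s: "range ?s \<subseteq> X" by (rule image_subsetI)
  have tail: "p q (?s M - ?s N) \<le> (\<Sum>j=N..<M. p q (v j))" if "1 \<le> q" "N \<le> M" for q M N
  proof -
    have "?s M - ?s N = (\<Sum>j=N..<M. v j)"
      by (rule sum_diff_nat_ivl[of 0 N M v, unfolded atLeast0LessThan]) (use that in auto)
    then show ?thesis by (simp only:) (rule p_sum[OF that(1) v])
  qed
  have "seminorm_Cauchy p ?s"
    unfolding seminorm_Cauchy_def
  proof (intro allI impI)
    fix q :: nat and \<epsilon> :: real assume q: "1 \<le> q" and "0 < \<epsilon>"
    then obtain N where N: "\<And>m n. N \<le> m \<Longrightarrow> norm (\<Sum>j=m..<n. p q (v j)) < \<epsilon>"
      using sm[OF q] unfolding summable_Cauchy by blast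
    have *: "p q (?s i - ?s j) < \<epsilon>" if "N \<le> j" "j \<le> i" for i j
    proof -
      have "p q (?s i - ?s j) \<le> (\<Sum>l=j..<i. p q (v l))" by (rule tail[OF q that(2)])
      also have "\<dots> \<le> norm (\<Sum>l=j..<i. p q (v l))" unfolding real_norm_def by (rule abs_ge_self)
      also have "\<dots> < \<epsilon>" by (rule N[OF that(1)])
      finally show ?thesis .
    qed
    have "p q (?s i - ?s j) < \<epsilon>" if "N \<le> i" "N \<le> j" for i j
    proof (cases "j \<le> i")
      case True
      then show ?thesis by (rule *[OF that(2)])
    next
      case False
      then have "p q (?s j - ?s i) < \<epsilon>" by (intro *[OF that(1)]) simp
      then show ?thesis by (simp only: p_minus_commute[OF q sX sX, of i j])
    qed
    then show "\<exists>N. \<forall>i\<ge>N. \<forall>j\<ge>N. p q (?s i - ?s j) < \<epsilon>" by blast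
  qed
  from complete[OF s this] obtain x where x: "limitin (seminorm_topology X p) ?s x sequentially" by blast
  have "\<forall>q\<ge>1. (\<lambda>J. p q (?s J - x)) \<longlonglongrightarrow> 0" using limitin_seminorm(2)[OF x _ s] by blast
  moreover have "x \<in> X" by (rule limitin_seminorm(1)[OF x])
  moreover have "(\<lambda>J. ?s J k) \<longlonglongrightarrow> x k" for k
    using coordinate_limit[OF s \<open>x \<in> X\<close>, of k] limitin_seminorm(2)[OF x _ s] by blast
  ultimately show ?thesis unfolding sum_fun_nth by blast
qed

lemma p_limit_le:
  assumes "range s \<subseteq> X" "x \<in> X" "1 \<le> q" "(\<lambda>n. p q (s n - x)) \<longlonglongrightarrow> 0" "y \<in> X" "\<forall>\<^sub>F n in sequentially. p q (s n - y) \<le> c"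
  shows "p q (x - y) \<le> c"
proof (rule tendsto_lowerbound)
  show "(\<lambda>n. c + p q (s n - x)) \<longlonglongrightarrow> c"
    using tendsto_add[OF tendsto_const assms(4)] by simp
  show "\<forall>\<^sub>F n in sequentially. p q (x - y) \<le> c + p q (s n - x)"
    using assms(6)
  proof eventually_elim
    case (elim n)
    have "s n \<in> X" using assms(1) by blast
    then show ?case
      using p_diff_triangle[of q x "s n" y] p_minus_commute[of q x "s n"] assms(2,3,5) elim by simp
  qed
qed simp

end

section \<open>Basis expansions and absolutely summable sequences\<close>

locale frechet_sequences_basis = frechet_sequences +
  assumes basis: "schauder_basis (seminorm_topology X p) unit_seq"
begin

lemma unit_seq_in: "unit_seq n \<in> X"
  using basis by (auto simp: schauder_basis_def topspace_seminorm_topology)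

lemma finite_sum_nth: "(\<Sum>n<N. scale_seq (b n) (unit_seq n)) k = (if k < N then b k else 0)"
  by (simp add: sum_fun_nth scale_seq_def unit_seq_def if_distrib[of "(*) _"] cong: if_cong)

lemma finite_sum_in: "(\<Sum>n<N. scale_seq (b n) (unit_seq n)) \<in> X"
  by (intro X_sum X_scale unit_seq_in)

text \<open>Coordinates are continuous on \<open>X\<close>, so the basis coefficients of
  \<open>x\<close> can only be its entries.\<close>

lemma expansion:
  assumes x: "x \<in> X" and q: "1 \<le> q"
  shows "(\<lambda>N. p q ((\<Sum>n<N. scale_seq (x n) (unit_seq n)) - x)) \<longlonglongrightarrow> 0"
proof -
  obtain b where b: "limitin (seminorm_topology X p) (\<lambda>N. \<Sum>n<N. scale_seq (b n) (unit_seq n)) x sequentially"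
    using basis x by (auto simp: schauder_basis_def topspace_seminorm_topology)
  have s: "range (\<lambda>N. \<Sum>n<N. scale_seq (b n) (unit_seq n)) \<subseteq> X" using finite_sum_in by blast
  have "b k = x k" for k
  proof -
    have "(\<lambda>N. (\<Sum>n<N. scale_seq (b n) (unit_seq n)) k) \<longlonglongrightarrow> x k"
      by (rule coordinate_limit[OF s x limitin_seminorm(2)[OF b _ s]])
    moreover have "(\<lambda>N. (\<Sum>n<N. scale_seq (b n) (unit_seq n)) k) \<longlonglongrightarrow> b k"
      unfolding finite_sum_nth
      by (rule tendsto_eventually) (auto simp: eventually_sequentially intro!: exI[of _ "Suc k"])
    ultimately show ?thesis using LIMSEQ_unique by blast
  qed
  then have "b = x" by blast
  then show ?thesis using limitin_seminorm(2)[OF b q s] by simp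
qed

text \<open>A term is the difference of two consecutive partial sums. Both indirect arguments about
  the shift below end by contradicting this.\<close>

lemma terms_tendsto_0:
  assumes x: "x \<in> X" and q: "1 \<le> q"
  shows "(\<lambda>n. cmod (x n) * p q (unit_seq n)) \<longlonglongrightarrow> 0"
proof (rule tendsto_sandwich[of "\<lambda>_. 0", OF _ _ tendsto_const])
  let ?s = "\<lambda>N. \<Sum>n<N. scale_seq (x n) (unit_seq n)"
  have "(\<lambda>N. p q (?s (Suc N) - x) + p q (?s N - x)) \<longlonglongrightarrow> 0 + 0"
    using expansion[OF assms] by (intro tendsto_add LIMSEQ_Suc)
  then show "(\<lambda>N. p q (?s (Suc N) - x) + p q (?s N - x)) \<longlonglongrightarrow> 0" by simp
  have "cmod (x n) * p q (unit_seq n) \<le> p q (?s (Suc n) - x) + p q (?s n - x)" for n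
  proof -
    have "cmod (x n) * p q (unit_seq n) = p q (?s (Suc n) - ?s n)"
      using p_scale[OF q unit_seq_in] by simp
    also have "\<dots> \<le> p q (?s (Suc n) - x) + p q (x - ?s n)"
      using p_diff_triangle[OF q finite_sum_in x finite_sum_in] .
    finally show ?thesis using p_minus_commute[OF q x finite_sum_in] by simp
  qed
  then show "\<forall>\<^sub>F n in sequentially. cmod (x n) * p q (unit_seq n) \<le> p q (?s (Suc n) - x) + p q (?s n - x)"
    by simp
  show "\<forall>\<^sub>F n in sequentially. 0 \<le> cmod (x n) * p q (unit_seq n)"
    using p_nonneg[OF q unit_seq_in] by simp
qed

text \<open>This places the weighted l1 algebra, in which the two generators are constructed, inside
  \<open>X\<close>.\<close>

lemma absolutely_convergent_in:
  assumes bound: "\<And>q. 1 \<le> q \<Longrightarrow> \<exists>c. \<forall>L. (\<Sum>n<L. cmod (f n) * p q (unit_seq n)) \<le> c"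
  shows "f \<in> X"
proof -
  let ?v = "\<lambda>n. scale_seq (f n) (unit_seq n)"
  have v: "?v n \<in> X" for n by (intro X_scale unit_seq_in)
  have sm: "summable (\<lambda>j. p q (?v j))" if q: "1 \<le> q" for q
  proof -
    obtain c where "\<forall>L. (\<Sum>n<L. cmod (f n) * p q (unit_seq n)) \<le> c" using bound[OF q] by blast
    then show ?thesis
      using p_scale[OF q unit_seq_in] p_nonneg[OF q unit_seq_in]
      by (intro summableI_nonneg_bounded[of _ c]) auto
  qed
  obtain x where x: "x \<in> X" "\<And>k. (\<lambda>J. \<Sum>j<J. ?v j k) \<longlonglongrightarrow> x k"
    using series_converges[of ?v, OF v sm] by blast
  have "f k = x k" for k
  proof -
    have "(\<Sum>j<J. ?v j k) = (if k < J then f k else 0)" for J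
      using finite_sum_nth[of f J k] by (simp only: sum_fun_nth)
    then have "(\<lambda>J. \<Sum>j<J. ?v j k) \<longlonglongrightarrow> f k"
      by (simp only:)
        (rule tendsto_eventually, auto simp: eventually_sequentially intro!: exI[of _ "Suc k"])
    then show ?thesis using x(2) LIMSEQ_unique by blast
  qed
  then have "f = x" by blast
  then show ?thesis using x(1) by simp
qed

lemma p_le_absolute_sum:
  assumes x: "x \<in> X" and q: "1 \<le> q" and c: "\<And>L. (\<Sum>n<L. cmod (x n) * p q (unit_seq n)) \<le> c"
  shows "p q x \<le> c"
proof -
  let ?s = "\<lambda>N. \<Sum>n<N. scale_seq (x n) (unit_seq n)"
  have "p q (?s N - 0) \<le> c" for N
    using p_sum[OF q, of "{..<N}" "\<lambda>n. scale_seq (x n) (unit_seq n)"] c[of N]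
      p_scale[OF q unit_seq_in] X_scale unit_seq_in by simp
  then have "p q (x - 0) \<le> c"
    using finite_sum_in by (intro p_limit_le[OF _ x q expansion[OF x q] X_zero]) auto
  then show ?thesis by simp
qed

end

subsection \<open>Mixing weighted shifts\<close>

lemma cauchy_prod_fps: "cauchy_prod (fps_nth f) (fps_nth g) = fps_nth (f * g)"
  by (rule ext) (simp add: cauchy_prod_def fps_mult_nth atLeast0AtMost)

lemma unit_seq_fps: "unit_seq n = fps_nth (fps_X ^ n)"
  by (rule ext) (simp add: unit_seq_def fps_X_power_iff)

lemma cauchy_prod_unit_seq: "cauchy_prod (unit_seq n) (unit_seq k) = unit_seq (n + k)"
  by (simp add: unit_seq_fps cauchy_prod_fps power_add)

lemma backward_shift_pow:
  assumes "\<And>n. w n \<noteq> 0"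
  shows "(\<Prod>k\<le>n. w k) * (backward_shift w ^^ N) x n = (\<Prod>k\<le>n + N. w k) * x (n + N)"
proof (induction N arbitrary: n)
  case (Suc N)
  have "(\<Prod>k\<le>n. w k) * (backward_shift w ^^ Suc N) x n
      = (\<Prod>k\<le>Suc n. w k) * (backward_shift w ^^ N) x (Suc n)"
    by (simp add: backward_shift_def)
  also have "\<dots> = (\<Prod>k\<le>Suc n + N. w k) * x (Suc n + N)" by (rule Suc)
  finally show ?case by simp
qed simp

lemma infinite_sets_strict_mono_choice:
  assumes "\<And>t :: nat. infinite (S t :: nat set)"
  shows "\<exists>f. strict_mono f \<and> (\<forall>t. f t \<in> S t)"
proof -
  have "\<exists>f. \<forall>t. f t \<in> S t \<and> f t < f (Suc t)"
  proof (rule dependent_nat_choice)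
    show "\<exists>x. x \<in> S 0" using assms[of 0] by (metis finite.emptyI ex_in_conv)
    show "\<exists>y. y \<in> S (Suc t) \<and> x < y" for x t
      using assms[of "Suc t"] by (meson infinite_nat_iff_unbounded)
  qed
  then show ?thesis by (meson strict_mono_Suc_iff)
qed

locale mixing_shift = frechet_sequences_basis +
  fixes w :: cseq
  assumes property_B: "property_B X p"
    and weight: "weight_seq w"
    and maps: "backward_shift w ` X \<subseteq> X"
    and mixing: "mixing (seminorm_topology X p) (backward_shift w)"
begin

lemma w_nonzero: "w n \<noteq> 0"
  using weight by (simp add: weight_seq_def)

lemma maps_pow: "x \<in> X \<Longrightarrow> (backward_shift w ^^ N) x \<in> X"
  by (induction N) (use maps in auto)

text \<open>Only the seminorms with index at least 1 carry information, hence the index shift.\<close>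

definition a :: "nat \<Rightarrow> nat \<Rightarrow> real" where
  "a q n = p (Suc q) (unit_seq n)"

lemma a_nonneg: "0 \<le> a q n"
  unfolding a_def by (rule p_nonneg[OF _ unit_seq_in]) simp

lemma a_mono: "q \<le> r \<Longrightarrow> a q n \<le> a r n"
  unfolding a_def by (rule p_mono[OF _ _ unit_seq_in]) simp_all

lemma a_submult: "a q (n + k) \<le> a q n * a q k"
  unfolding a_def cauchy_prod_unit_seq[symmetric]
  by (rule p_submult[OF _ unit_seq_in unit_seq_in]) simp

lemma a_pos: "\<exists>q. \<forall>n. 0 < a q n"
proof -
  have "\<exists>q\<ge>1. \<forall>n. 0 < p q (unit_seq n)" using property_B unfolding property_B_def by (elim conjE)
  then obtain q where "1 \<le> q" "\<forall>n. 0 < p q (unit_seq n)" by blast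
  then show ?thesis by (intro exI[of _ "q - 1"]) (simp add: a_def)
qed

text \<open>If no pair \<open>t\<close>, \<open>C\<close> worked, a lacunary series of unit sequences would lie in \<open>X\<close>
  while the terms of its shift do not tend to 0.\<close>

lemma shift_bounded: "\<exists>t C. \<forall>n. cmod (w (Suc n)) * a q n \<le> C * a t (Suc n)"
proof (rule ccontr)
  assume neg: "\<not> ?thesis"
  obtain q0 where q0: "\<And>n. 0 < a q0 n" using a_pos by blast
  \<comment> \<open>The positions at which the bound with index \<open>t + q0\<close> and constant
    \<open>2 ^ t\<close> fails; the offset \<open>q0\<close> keeps the weights positive.\<close>
  define S where "S t = {n. 2 ^ t * a (t + q0) (Suc n) < cmod (w (Suc n)) * a q n}" for t :: nat
  have "infinite (S t)" for t
  proof
    assume fin: "finite (S t)"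
    \<comment> \<open>Adding the finitely many exceptional ratios to \<open>2 ^ t\<close> would give
      a constant valid at every position.\<close>
    define C where "C = 2 ^ t + (\<Sum>n\<in>S t. cmod (w (Suc n)) * a q n / a (t + q0) (Suc n))"
    have pos: "0 < a (t + q0) n" for n
      using q0[of n] a_mono[of q0 "t + q0" n] by simp
    have nn: "0 \<le> (\<Sum>n\<in>S t. cmod (w (Suc n)) * a q n / a (t + q0) (Suc n))"
      by (intro sum_nonneg divide_nonneg_nonneg mult_nonneg_nonneg a_nonneg norm_ge_zero)
    have "cmod (w (Suc n)) * a q n \<le> C * a (t + q0) (Suc n)" for n
    proof (cases "n \<in> S t")
      case True
      have "cmod (w (Suc n)) * a q n / a (t + q0) (Suc n)
          \<le> (\<Sum>n\<in>S t. cmod (w (Suc n)) * a q n / a (t + q0) (Suc n))"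
        by (rule member_le_sum[OF True _ fin]) (simp add: a_nonneg)
      also have "\<dots> \<le> C" by (simp add: C_def)
      finally show ?thesis using pos by (simp add: pos_divide_le_eq)
    next
      case False
      then have "cmod (w (Suc n)) * a q n \<le> 2 ^ t * a (t + q0) (Suc n)" by (simp add: S_def not_less)
      also have "\<dots> \<le> C * a (t + q0) (Suc n)"
        by (rule mult_right_mono) (use nn in \<open>simp_all add: C_def a_nonneg\<close>)
      finally show ?thesis .
    qed
    then show False using neg by blast
  qed
  then obtain f where f: "strict_mono f" "\<And>t. f t \<in> S t"
    using infinite_sets_strict_mono_choice by metis
  have pos: "0 < a (t + q0) n" for t n
    using q0[of n] a_mono[of q0 "t + q0" n] by simp
  \<comment> \<open>Normalised so that term \<open>t\<close> of the series has size
    \<open>1 / 2 ^ t\<close> with respect to \<open>a (t + q0)\<close>, whereas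
    \<open>f t \<in> S t\<close> makes its shift larger than 1 with respect to
    \<open>a q\<close>.\<close>
  define c where "c t = 1 / (2 ^ t * a (t + q0) (Suc (f t)))" for t
  have c_pos: "0 < c t" for t using pos by (simp add: c_def)
  define v where "v t = scale_seq (of_real (c t)) (unit_seq (Suc (f t)))" for t
  have v: "v t \<in> X" for t unfolding v_def by (intro X_scale unit_seq_in)
  have sm: "summable (\<lambda>t. p r (v t))" if r: "1 \<le> r" for r
  proof (rule summable_comparison_test')
    show "summable (\<lambda>t. (1 / 2) ^ t :: real)" by (rule summable_geometric) simp
    fix t assume "r \<le> t"
    have "p r (v t) \<le> p (Suc (t + q0)) (v t)" by (rule p_mono[OF r _ v]) (use \<open>r \<le> t\<close> in simp)
    also have "\<dots> = c t * a (t + q0) (Suc (f t))"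
      unfolding v_def a_def using p_scale[OF _ unit_seq_in] c_pos[of t] by simp
    also have "\<dots> = (1 / 2) ^ t" using pos[of t "Suc (f t)"] by (simp add: c_def power_one_over)
    finally show "norm (p r (v t)) \<le> (1 / 2) ^ t" using p_nonneg[OF r v] by simp
  qed
  obtain x where x: "x \<in> X" "\<And>k. (\<lambda>J. \<Sum>j<J. v j k) \<longlonglongrightarrow> x k"
    using series_converges[OF v sm] by blast
  have x_coord: "x (Suc (f t)) = of_real (c t)" for t
  proof -
    have "v j (Suc (f t)) = (if j = t then of_real (c t) else 0)" for j
      using f(1) by (auto simp: v_def scale_seq_def unit_seq_def strict_mono_eq)
    then have "(\<Sum>j<J. v j (Suc (f t))) = of_real (c t)" if "Suc t \<le> J" for J
      using that by simp
    then have "(\<lambda>J. \<Sum>j<J. v j (Suc (f t))) \<longlonglongrightarrow> of_real (c t)"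
      by (intro tendsto_eventually eventually_sequentiallyI[of "Suc t"]) simp
    then show ?thesis using x(2) LIMSEQ_unique by blast
  qed
  have "backward_shift w x \<in> X" using maps x(1) by blast
  from terms_tendsto_0[OF this, of "Suc q"]
  have "(\<lambda>n. cmod (backward_shift w x n) * a q n) \<longlonglongrightarrow> 0" by (simp add: a_def)
  from LIMSEQ_subseq_LIMSEQ[OF this f(1)]
  have "(\<lambda>t. cmod (backward_shift w x (f t)) * a q (f t)) \<longlonglongrightarrow> 0" by (simp add: o_def)
  then have "\<forall>\<^sub>F t in sequentially. cmod (backward_shift w x (f t)) * a q (f t) < 1"
    by (rule order_tendstoD) simp
  then obtain t where t: "cmod (backward_shift w x (f t)) * a q (f t) < 1"
    using eventually_happens'[OF sequentially_bot] by blast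
  have "1 < c t * (cmod (w (Suc (f t))) * a q (f t))"
    using f(2)[of t] pos[of t "Suc (f t)"] by (simp add: S_def c_def pos_less_divide_eq)
  also have "\<dots> = cmod (backward_shift w x (f t)) * a q (f t)"
    using c_pos[of t] by (simp add: backward_shift_def x_coord norm_mult)
  finally show False using t by simp
qed

text \<open>Mixing is applied to a small ball and to the vectors with entry 0 near 1. Entry 0 of the
  \<open>n\<close>-th iterate of \<open>h\<close> is the weight product times \<open>h n\<close>,
  and the admissible \<open>n\<close> are cofinite, so they meet \<open>S\<close> beyond
  \<open>K\<close>.\<close>

lemma mixing_small_vector:
  assumes k: "1 \<le> k" and "0 < \<eta>" and S: "infinite S"
  shows "\<exists>h\<in>X. \<exists>n\<in>S. K \<le> n \<and> p k h < \<eta> \<and> 1 / 2 < cmod (\<Prod>k\<le>n. w k) * cmod (h n)"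
proof -
  let ?U = "{x \<in> X. p k x < \<eta>}" and ?V = "{x \<in> X. x 0 \<in> ball 1 (1 / 2)}"
  have "0 \<in> ?U" using X_zero p_zero[OF k] \<open>0 < \<eta>\<close> by simp
  moreover have "unit_seq 0 \<in> ?V" using unit_seq_in by (simp add: unit_seq_def)
  ultimately have "finite (- {n. (backward_shift w ^^ n) ` ?U \<inter> ?V \<noteq> {}})"
    using mixing openin_ball[OF k, of \<eta>] openin_coordinate[of "ball 1 (1 / 2)" 0]
    unfolding mixing_def by blast
  then have "finite (- {n. (backward_shift w ^^ n) ` ?U \<inter> ?V \<noteq> {}} \<union> {..<K})" by simp
  then obtain n where n: "n \<in> S" "n \<notin> - {n. (backward_shift w ^^ n) ` ?U \<inter> ?V \<noteq> {}} \<union> {..<K}"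
    using S by (meson finite_subset subsetI)
  then obtain h where h: "h \<in> X" "p k h < \<eta>" "(backward_shift w ^^ n) h 0 \<in> ball 1 (1 / 2)" by blast
  have "(backward_shift w ^^ n) h 0 = (\<Prod>k\<le>n. w k) * h n"
    using backward_shift_pow[of w 0 n h, OF w_nonzero] weight by (simp add: weight_seq_def)
  then have "cmod (1 - (\<Prod>k\<le>n. w k) * h n) < 1 / 2" using h(3) by (simp add: dist_norm)
  then have "1 / 2 < cmod ((\<Prod>k\<le>n. w k) * h n)"
    using norm_triangle_ineq2[of 1 "(\<Prod>k\<le>n. w k) * h n"] by simp
  then show ?thesis using n h by (intro bexI[of _ h] bexI[of _ n]) (auto simp: norm_mult)
qed

text \<open>A gliding hump: small vectors provided by mixing are added up to an element of \<open>X\<close>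
  whose basis expansion has terms that do not tend to 0.\<close>

lemma shift_mixing: "(\<lambda>n. a q n / cmod (\<Prod>k\<le>n. w k)) \<longlonglongrightarrow> 0"
proof (rule ccontr)
  assume "\<not> ?thesis"
  then obtain c where c: "0 < c"
    and "\<not> (\<forall>\<^sub>F n in sequentially. dist (a q n / cmod (\<Prod>k\<le>n. w k)) 0 < c)"
    unfolding tendsto_iff by blast
  moreover define S where "S = {n. \<not> dist (a q n / cmod (\<Prod>k\<le>n. w k)) 0 < c}"
  ultimately have S: "infinite S"
    by (simp add: eventually_cofinite flip: cofinite_eq_sequentially)
  have S_D: "c * cmod (\<Prod>k\<le>n. w k) \<le> a q n" if "n \<in> S" for n
    using that a_nonneg[of q n] w_nonzero by (simp add: S_def not_less pos_le_divide_eq abs_mult)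
  define P where "P j s \<longleftrightarrow> fst s \<in> X \<and> 1 \<le> fst (snd s) \<and> 0 < snd (snd s) \<and> snd (snd s) \<le> (1 / 2) ^ j"
    for j :: nat and s :: "cseq \<times> nat \<times> real"
  \<comment> \<open>The last clause is the hump: every element of the next ball has a term of size
    at least \<open>c / 8\<close> at some position \<open>n \<ge> j\<close>.\<close>
  define Q where "Q j s s' \<longleftrightarrow> (\<exists>h\<in>X. fst s' = fst s + h \<and> p (fst (snd s)) h \<le> snd (snd s) / 2 \<and>
      max (fst (snd s)) (Suc j) \<le> fst (snd s') \<and> snd (snd s') \<le> snd (snd s) / 2 \<and>
      (\<exists>n\<ge>j. \<forall>x\<in>X. p (fst (snd s')) (x - fst s') \<le> snd (snd s') \<longrightarrow> c / 8 \<le> cmod (x n) * a q n))"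
    for j :: nat and s s' :: "cseq \<times> nat \<times> real"
  have "\<exists>f. \<forall>j. P j (f j) \<and> Q j (f j) (f (Suc j))"
  proof (rule dependent_nat_choice)
    show "\<exists>s. P 0 s" by (rule exI[of _ "(0, 1, 1)"]) (simp add: P_def X_zero)
  next
    fix s' j assume P: "P j s'"
    obtain s k \<eta> where s': "s' = (s, k, \<eta>)" by (cases s')
    have s: "s \<in> X" and k: "1 \<le> k" and \<eta>: "0 < \<eta>" "\<eta> \<le> (1 / 2) ^ j" using P by (simp_all add: P_def s')
    have "\<forall>\<^sub>F n in sequentially. cmod (s n) * a q n < c / 8"
      unfolding a_def by (rule order_tendstoD[OF terms_tendsto_0[OF s]]) (use c in simp_all)
    then obtain K where K: "\<And>n. K \<le> n \<Longrightarrow> cmod (s n) * a q n < c / 8"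
      unfolding eventually_sequentially by blast
    have "0 < \<eta> / 2" using \<eta> by simp
    from mixing_small_vector[OF k this S, of "max K j"]
    obtain h n where h: "h \<in> X" "n \<in> S" "max K j \<le> n" "p k h < \<eta> / 2"
      "1 / 2 < cmod (\<Prod>k\<le>n. w k) * cmod (h n)" by blast
    have "c / 2 < c * (cmod (\<Prod>k\<le>n. w k) * cmod (h n))" using h(5) c by simp
    also have "\<dots> = c * cmod (\<Prod>k\<le>n. w k) * cmod (h n)" by simp
    also have "\<dots> \<le> a q n * cmod (h n)" by (intro mult_right_mono S_D h) simp
    finally have hn: "c / 2 < cmod (h n) * a q n" by (simp add: mult.commute)
    then have "a q n \<noteq> 0" using c by auto
    then have apos: "0 < a q n" using a_nonneg[of q n] by simp
    have "cmod (h n) * a q n \<le> (cmod ((s + h) n) + cmod (s n)) * a q n"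
      using norm_triangle_ineq4[of "(s + h) n" "s n"] apos by (intro mult_right_mono) auto
    \<comment> \<open>The budget: the new vector contributes more than \<open>c / 2\<close> at
      \<open>n\<close>, the old sum less than \<open>c / 8\<close> beyond \<open>K\<close>, and
      \<open>c / 8\<close> is reserved for later changes.\<close>
    then have sh: "c / 4 < cmod ((s + h) n) * a q n"
      using hn K[of n] h(3) c by (simp add: distrib_right)
    obtain r \<delta> where r: "1 \<le> r" "0 < \<delta>" "\<forall>x\<in>X. p r x < \<delta> \<longrightarrow> cmod (x n) < c / 8 / a q n"
      using coordinate_small[of "c / 8 / a q n" n] c apos by auto
    let ?k = "max r (max k (Suc j))" and ?\<eta> = "min (\<delta> / 2) (\<eta> / 2)"
    have shX: "s + h \<in> X" by (rule X_add[OF s h(1)])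
    have "c / 8 \<le> cmod (x n) * a q n" if x: "x \<in> X" "p ?k (x - (s + h)) \<le> ?\<eta>" for x
    proof -
      have xX: "x - (s + h) \<in> X" by (rule X_diff[OF x(1) shX])
      have "p r (x - (s + h)) \<le> p ?k (x - (s + h))" by (rule p_mono[OF r(1) _ xX]) simp
      then have "p r (x - (s + h)) < \<delta>" using x(2) r(2) by linarith
      then have "cmod ((x - (s + h)) n) < c / 8 / a q n" using r(3) xX by blast
      then have "cmod ((x - (s + h)) n) * a q n < c / 8" using apos by (simp only: pos_less_divide_eq)
      moreover have "cmod ((s + h) n) * a q n \<le> (cmod (x n) + cmod ((x - (s + h)) n)) * a q n"
        using norm_triangle_ineq4[of "x n" "(x - (s + h)) n"] apos by (intro mult_right_mono) auto
      ultimately show ?thesis using sh unfolding distrib_right by linarith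
    qed
    then have "\<exists>n\<ge>j. \<forall>x\<in>X. p ?k (x - (s + h)) \<le> ?\<eta> \<longrightarrow> c / 8 \<le> cmod (x n) * a q n"
      using h(3) by (intro exI[of _ n]) auto
    moreover have "p k h \<le> \<eta> / 2" "max k (Suc j) \<le> ?k" "?\<eta> \<le> \<eta> / 2" using h(4) by simp_all
    ultimately have "Q j s' (s + h, ?k, ?\<eta>)"
      unfolding Q_def s' fst_conv snd_conv by - (rule bexI[OF _ h(1)], intro conjI, rule refl)
    moreover have "1 \<le> ?k" "0 < ?\<eta>" "?\<eta> \<le> (1 / 2) ^ Suc j" using k \<eta> r by simp_all
    then have "P (Suc j) (s + h, ?k, ?\<eta>)"
      unfolding P_def fst_conv snd_conv using shX by (intro conjI)
    ultimately show "\<exists>t. P (Suc j) t \<and> Q j s' t" by blast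
  qed
  then obtain f where f: "\<And>j. P j (f j)" "\<And>j. Q j (f j) (f (Suc j))" by blast
  define s k \<eta> where "s j = fst (f j)" and "k j = fst (snd (f j))" and "\<eta> j = snd (snd (f j))" for j
  have s: "s j \<in> X" and k: "1 \<le> k j" and \<eta>: "0 < \<eta> j" "\<eta> j \<le> (1 / 2) ^ j" for j
    using f(1)[of j] unfolding P_def s_def k_def \<eta>_def by - (elim conjE; assumption)+
  have step: "\<exists>h\<in>X. s (Suc j) = s j + h \<and> p (k j) h \<le> \<eta> j / 2 \<and>
      max (k j) (Suc j) \<le> k (Suc j) \<and> \<eta> (Suc j) \<le> \<eta> j / 2 \<and>
      (\<exists>n\<ge>j. \<forall>x\<in>X. p (k (Suc j)) (x - s (Suc j)) \<le> \<eta> (Suc j) \<longrightarrow> c / 8 \<le> cmod (x n) * a q n)" for j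
    using f(2)[of j] unfolding Q_def s_def k_def \<eta>_def .
  then have "\<forall>j. \<exists>h. h \<in> X \<and> s (Suc j) = s j + h \<and> p (k j) h \<le> \<eta> j / 2" by meson
  then obtain h where h: "\<And>j. h j \<in> X" "\<And>j. s (Suc j) = s j + h j" "\<And>j. p (k j) (h j) \<le> \<eta> j / 2"
    by metis
  have k_Suc: "max (k j) (Suc j) \<le> k (Suc j)" and \<eta>_Suc: "\<eta> (Suc j) \<le> \<eta> j / 2" for j
    using step[of j] by - (elim bexE conjE; assumption)+
  have k_mono: "k i \<le> k j" if "i \<le> j" for i j
    by (rule lift_Suc_mono_le[of k, OF _ that]) (use k_Suc in simp)
  have k_ge: "j \<le> k j" for j by (cases j) (use k_Suc in auto)
  have sm: "summable (\<lambda>j. p r (h j))" if r: "1 \<le> r" for r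
  proof (rule summable_comparison_test')
    show "summable (\<lambda>t. (1 / 2) ^ t :: real)" by (rule summable_geometric) simp
    fix j assume "r \<le> j"
    then have "p r (h j) \<le> p (k j) (h j)" using k_ge[of j] by (intro p_mono[OF r _ h(1)]) simp
    also have "\<dots> \<le> (1 / 2) ^ j" using h(3)[of j] \<eta>[of j] by simp
    finally show "norm (p r (h j)) \<le> (1 / 2) ^ j" using p_nonneg[OF r h(1)] by simp
  qed
  obtain y where y: "y \<in> X" "\<And>r. 1 \<le> r \<Longrightarrow> (\<lambda>J. p r ((\<Sum>j<J. h j) - y)) \<longlonglongrightarrow> 0"
    using series_converges[of h, OF h(1) sm] by meson
  define x where "x = s 0 + y"
  have x: "x \<in> X" unfolding x_def by (rule X_add[OF s y(1)])
  have s_sum: "s J = s 0 + (\<Sum>j<J. h j)" for J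
  proof (induction J)
    case 0 show ?case by (simp only: lessThan_0 sum.empty add_0_right)
  next
    case (Suc J)
    show ?case unfolding h(2) sum.lessThan_Suc by (subst Suc) (rule add.assoc)
  qed
  have "s J - x = (\<Sum>j<J. h j) - y" for J
    unfolding s_sum[of J] x_def by (rule add_diff_cancel_left)
  then have s_lim: "(\<lambda>J. p r (s J - x)) \<longlonglongrightarrow> 0" if "1 \<le> r" for r
    using y(2)[OF that] by (simp only:)
  have tail: "p (k j) (s J - s j) \<le> \<eta> j - \<eta> J" if "j \<le> J" for j J
    using that
  proof (induction J rule: dec_induct)
    case base show ?case using p_zero[OF k] by (simp only: diff_self)
  next
    case (step J)
    have "p (k j) (s (Suc J) - s j) \<le> p (k j) (s (Suc J) - s J) + p (k j) (s J - s j)"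
      by (rule p_diff_triangle[OF k s s s])
    also have "s (Suc J) - s J = h J" unfolding h(2) by (rule add_diff_cancel_left')
    also have "p (k j) (h J) \<le> p (k J) (h J)" by (rule p_mono[OF k k_mono[OF step(1)] h(1)])
    finally show ?case using h(3)[of J] step(3) \<eta>_Suc[of J] by linarith
  qed
  have close: "p (k j) (x - s j) \<le> \<eta> j" for j
  proof (rule p_limit_le[OF _ x k s_lim[OF k] s])
    show "range s \<subseteq> X" using s by (rule image_subsetI)
    show "\<forall>\<^sub>F J in sequentially. p (k j) (s J - s j) \<le> \<eta> j"
    proof (rule eventually_sequentiallyI)
      fix J assume "j \<le> J"
      from tail[OF this] \<eta>(1)[of J] show "p (k j) (s J - s j) \<le> \<eta> j" by linarith
    qed
  qed
  have "\<forall>\<^sub>F n in sequentially. cmod (x n) * a q n < c / 8"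
    unfolding a_def by (rule order_tendstoD[OF terms_tendsto_0[OF x]]) (use c in simp_all)
  then obtain K where K: "\<And>n. K \<le> n \<Longrightarrow> cmod (x n) * a q n < c / 8"
    unfolding eventually_sequentially by blast
  have "\<exists>n\<ge>K. \<forall>x\<in>X. p (k (Suc K)) (x - s (Suc K)) \<le> \<eta> (Suc K) \<longrightarrow> c / 8 \<le> cmod (x n) * a q n"
    using step[of K] by - (elim bexE conjE; assumption)
  then obtain n where n: "K \<le> n"
    "\<forall>x\<in>X. p (k (Suc K)) (x - s (Suc K)) \<le> \<eta> (Suc K) \<longrightarrow> c / 8 \<le> cmod (x n) * a q n"
    by (elim exE conjE)
  have "c / 8 \<le> cmod (x n) * a q n" by (rule mp[OF bspec[OF n(2) x] close])
  then show False using K[OF n(1)] by linarith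
qed

lemma root_condition:
  assumes "2 \<le> m" "1 \<le> M"
  shows "\<exists>\<rho>. \<forall>t. \<exists>\<tau> C. \<forall>k\<le>M. \<forall>n\<ge>M.
        a t (m * n) * a r (n - k) \<le> C * a \<tau> (m * n) powr (1 / real m) * a \<rho> (m * n - k)"
proof -
  have B3: "\<forall>m\<ge>2. \<forall>M\<ge>1. \<forall>r\<ge>1. \<exists>\<rho>\<ge>1. \<forall>t\<ge>1. \<exists>\<tau>\<ge>1. \<exists>C>0. \<forall>k\<le>M. \<forall>n\<ge>M.
        p t (unit_seq (m * n)) * p r (unit_seq (n - k))
          \<le> C * p \<tau> (unit_seq (m * n)) powr (1 / real m) * p \<rho> (unit_seq (m * n - k))"
    using property_B unfolding property_B_def by (elim conjE)
  have "\<exists>\<rho>\<ge>1. \<forall>t\<ge>1. \<exists>\<tau>\<ge>1. \<exists>C>0. \<forall>k\<le>M. \<forall>n\<ge>M.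
        p t (unit_seq (m * n)) * p (Suc r) (unit_seq (n - k))
          \<le> C * p \<tau> (unit_seq (m * n)) powr (1 / real m) * p \<rho> (unit_seq (m * n - k))"
    by (rule B3[rule_format]) (use assms in simp_all)
  then obtain \<rho> where \<rho>: "1 \<le> \<rho>" "\<forall>t\<ge>1. \<exists>\<tau>\<ge>1. \<exists>C>0. \<forall>k\<le>M. \<forall>n\<ge>M.
        p t (unit_seq (m * n)) * p (Suc r) (unit_seq (n - k))
          \<le> C * p \<tau> (unit_seq (m * n)) powr (1 / real m) * p \<rho> (unit_seq (m * n - k))"
    by (elim exE conjE)
  show ?thesis
  proof (rule exI[of _ "\<rho> - 1"], rule allI)
    fix t
    have "\<exists>\<tau>\<ge>1. \<exists>C>0. \<forall>k\<le>M. \<forall>n\<ge>M.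
        p (Suc t) (unit_seq (m * n)) * p (Suc r) (unit_seq (n - k))
          \<le> C * p \<tau> (unit_seq (m * n)) powr (1 / real m) * p \<rho> (unit_seq (m * n - k))"
      by (rule \<rho>(2)[rule_format]) simp
    then obtain \<tau> C where \<tau>: "1 \<le> \<tau>" "\<forall>k\<le>M. \<forall>n\<ge>M.
        p (Suc t) (unit_seq (m * n)) * p (Suc r) (unit_seq (n - k))
          \<le> C * p \<tau> (unit_seq (m * n)) powr (1 / real m) * p \<rho> (unit_seq (m * n - k))"
      by blast
    have eq: "Suc (\<tau> - 1) = \<tau>" "Suc (\<rho> - 1) = \<rho>" using \<tau>(1) \<rho>(1) by simp_all
    show "\<exists>\<tau> C. \<forall>k\<le>M. \<forall>n\<ge>M.
        a t (m * n) * a r (n - k) \<le> C * a \<tau> (m * n) powr (1 / real m) * a (\<rho> - 1) (m * n - k)"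
      unfolding a_def by (rule exI[of _ "\<tau> - 1"], rule exI[of _ C], unfold eq) (rule \<tau>(2))
  qed
qed

sublocale weighted_shift a w
  by unfold_locales
    (rule a_nonneg a_mono a_submult a_pos w_nonzero shift_bounded shift_mixing root_condition; assumption)+

end

subsection \<open>The algebra\<close>

lemma fps_nth_sum_scale: "fps_nth (\<Sum>i\<in>I. fps_const (c i) * f i) = (\<Sum>i\<in>I. scale_seq (c i) (fps_nth (f i)))"
  by (rule ext) (simp add: fps_sum_nth sum_fun_nth scale_seq_def)

lemma cauchy_prod_add:
  "cauchy_prod (x + y) z = cauchy_prod x z + cauchy_prod y z"
  "cauchy_prod z (x + y) = cauchy_prod z x + cauchy_prod z y"
  by (rule ext, simp add: cauchy_prod_def algebra_simps sum.distrib)+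

lemma cauchy_prod_scale:
  "cauchy_prod (scale_seq c x) z = scale_seq c (cauchy_prod x z)"
  "cauchy_prod z (scale_seq c x) = scale_seq c (cauchy_prod z x)"
  by (rule ext, simp add: cauchy_prod_def scale_seq_def sum_distrib_left mult_ac)+

lemma cauchy_prod_zero: "cauchy_prod 0 z = 0" "cauchy_prod z 0 = 0"
  by (rule ext, simp add: cauchy_prod_def)+

lemma subalgebra_seq_span:
  assumes S: "\<And>x y. x \<in> S \<Longrightarrow> y \<in> S \<Longrightarrow> cauchy_prod x y \<in> S"
  shows "subalgebra_seq (seq.span S)"
proof -
  have left: "cauchy_prod x y \<in> seq.span S" if "x \<in> S" "y \<in> seq.span S" for x y
    using that(2)
  proof (induction rule: seq.span_induct_alt)
    case base show ?case unfolding cauchy_prod_zero by (rule seq.span_zero)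
  next
    case (step c y z)
    show ?case unfolding cauchy_prod_add cauchy_prod_scale
      by (intro seq.span_add seq.span_scale seq.span_base S that(1) step)
  qed
  have "cauchy_prod x y \<in> seq.span S" if "x \<in> seq.span S" "y \<in> seq.span S" for x y
    using that(1)
  proof (induction rule: seq.span_induct_alt)
    case base show ?case unfolding cauchy_prod_zero by (rule seq.span_zero)
  next
    case (step c x z)
    show ?case unfolding cauchy_prod_add cauchy_prod_scale
      by (intro seq.span_add seq.span_scale left that(2) step)
  qed
  then show ?thesis unfolding subalgebra_seq_def by (intro conjI ballI seq.subspace_span)
qed

text \<open>Since \<open>f\<close> may identify indices, one index is chosen for each vector; the
  coefficients are then attached to exponents and not to values.\<close>

lemma span_image_representation:
  assumes "g \<in> seq.span (f ` \<Gamma>)"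
  shows "\<exists>F \<alpha>. finite F \<and> F \<subseteq> \<Gamma> \<and> g = (\<Sum>i\<in>F. scale_seq (\<alpha> i) (f i))"
proof -
  obtain t r where t: "finite t" "t \<subseteq> f ` \<Gamma>" "g = (\<Sum>v\<in>t. scale_seq (r v) v)"
    using assms unfolding seq.span_explicit by blast
  from t(2) obtain F where F: "F \<subseteq> \<Gamma>" "inj_on f F" "t = f ` F" unfolding subset_image_inj by blast
  have "finite F" using t(1) F by (simp add: finite_image_iff)
  moreover have "g = (\<Sum>i\<in>F. scale_seq (r (f i)) (f i))"
    unfolding t(3) F(3) by (subst sum.reindex[OF F(2)]) (simp only: o_def)
  ultimately show ?thesis using F(1) by (intro exI[of _ F] exI[of _ "\<lambda>i. r (f i)"] conjI)
qed

context mixing_shift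
begin

section \<open>Passage from weighted l1 estimates to hypercyclic vectors in \<open>X\<close>\<close>

lemma l1_le_in:
  assumes "\<And>q. \<exists>c. l1_le q f c"
  shows "fps_nth f \<in> X"
proof (rule absolutely_convergent_in)
  fix q :: nat assume "1 \<le> q"
  then show "\<exists>c. \<forall>L. (\<Sum>n<L. cmod (f $ n) * p q (unit_seq n)) \<le> c"
    using assms[of "q - 1"] by (simp add: l1_le_def a_def)
qed

lemma l1_le_imp_p_le:
  assumes "fps_nth f \<in> X" "l1_le q f c"
  shows "p (Suc q) (fps_nth f) \<le> c"
  by (rule p_le_absolute_sum) (use assms in \<open>auto simp: l1_le_def a_def\<close>)

lemma backward_shift_pow_fps: "(backward_shift w ^^ N) (fps_nth f) = fps_nth (shift_pow N f)"
proof
  fix n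
  have "W n * (backward_shift w ^^ N) (fps_nth f) n = W (n + N) * f $ (n + N)"
    unfolding W_def by (rule backward_shift_pow[OF w_nonzero])
  then show "(backward_shift w ^^ N) (fps_nth f) n = shift_pow N f $ n"
    by (simp add: shift_pow_def nonzero_eq_divide_eq mult.commute)
qed

text \<open>By the basis expansion polynomials are dense in \<open>X\<close>, so approximating them
  suffices: half of \<open>\<epsilon>\<close> goes to truncating \<open>y\<close>, half to the
  orbit.\<close>

lemma HC_I:
  assumes f: "fps_nth f \<in> X"
    and approx: "\<And>z d q \<epsilon>. 0 < \<epsilon> \<Longrightarrow> degree_le z d \<Longrightarrow> \<exists>N. l1_le q (shift_pow N f - z) \<epsilon>"
  shows "fps_nth f \<in> HC (seminorm_topology X p) (backward_shift w)"
proof -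
  let ?T = "seminorm_topology X p" and ?B = "backward_shift w"
  have "y \<in> ?T closure_of range (\<lambda>n. (?B ^^ n) (fps_nth f))" if y: "y \<in> X" for y
    unfolding in_closure_of topspace_seminorm_topology
  proof (intro conjI allI impI y)
    fix U assume "y \<in> U \<and> openin ?T U"
    then obtain q \<epsilon> where q: "1 \<le> q" "0 < \<epsilon>" "{z \<in> X. p q (z - y) < \<epsilon>} \<subseteq> U"
      unfolding openin_seminorm_topology by blast
    let ?s = "\<lambda>N. \<Sum>n<N. scale_seq (y n) (unit_seq n)"
    have "\<forall>\<^sub>F M in sequentially. p q (?s M - y) < \<epsilon> / 2"
      by (rule order_tendstoD[OF expansion[OF y q(1)]]) (use q(2) in simp)
    then obtain M where M: "p q (?s M - y) < \<epsilon> / 2"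
      using eventually_happens'[OF sequentially_bot] by blast
    define z where "z = Abs_fps (\<lambda>n. if n < M then y n else 0)"
    have z: "fps_nth z = ?s M"
      by (rule ext) (simp only: finite_sum_nth z_def fps_nth_Abs_fps)
    have "degree_le z M" by (simp add: degree_le_def z_def)
    then obtain N where N: "l1_le (q - 1) (shift_pow N f - z) (\<epsilon> / 2)"
      using approx[of "\<epsilon> / 2" z M "q - 1"] q(2) by auto
    have eq: "fps_nth (shift_pow N f - z) = (?B ^^ N) (fps_nth f) - ?s M"
      unfolding backward_shift_pow_fps z[symmetric] by (rule ext) simp
    have BX: "(?B ^^ N) (fps_nth f) \<in> X" by (rule maps_pow[OF f])
    have "fps_nth (shift_pow N f - z) \<in> X" unfolding eq by (rule X_diff[OF BX finite_sum_in])
    from l1_le_imp_p_le[OF this N] have "p q ((?B ^^ N) (fps_nth f) - ?s M) \<le> \<epsilon> / 2"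
      using q(1) unfolding eq by simp
    moreover have "p q ((?B ^^ N) (fps_nth f) - y) \<le> p q ((?B ^^ N) (fps_nth f) - ?s M) + p q (?s M - y)"
      by (rule p_diff_triangle[OF q(1) BX finite_sum_in y])
    ultimately have "p q ((?B ^^ N) (fps_nth f) - y) < \<epsilon>" using M by linarith
    then have "(?B ^^ N) (fps_nth f) \<in> U" using q(3) BX by blast
    then show "\<exists>y'. y' \<in> range (\<lambda>n. (?B ^^ n) (fps_nth f)) \<and> y' \<in> U" by blast
  qed
  moreover have "?T closure_of range (\<lambda>n. (?B ^^ n) (fps_nth f)) \<subseteq> X"
    using closure_of_subset_topspace[of ?T] by (simp only: topspace_seminorm_topology)
  ultimately show ?thesis using f unfolding HC_def topspace_seminorm_topology by blast
qed

text \<open>Modulo products, the generators \<open>x * y ^ j\<close> of the algebra spanned by the monomials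
  \<open>x ^ i * y ^ j\<close> with \<open>i \<ge> 1\<close> stay linearly independent.\<close>

lemma exists_hypercyclic_algebra:
  "\<exists>A\<subseteq>X. subalgebra_seq A \<and> \<not> finitely_generated_alg A \<and>
     A - {0} \<subseteq> HC (seminorm_topology X p) (backward_shift w)"
proof -
  obtain x y where x: "\<forall>q. \<exists>b. l1_le q x b" and y: "\<forall>q. \<exists>b. l1_le q y b"
    and xy_all: "\<forall>F \<alpha>. finite F \<longrightarrow> (0, 0) \<notin> F \<longrightarrow> (\<exists>ij\<in>F. \<alpha> ij \<noteq> 0) \<longrightarrow>
      (\<forall>z d q. \<forall>\<epsilon>>0. degree_le z d \<longrightarrow>
        (\<exists>N. l1_le q (shift_pow N (\<Sum>ij\<in>F. fps_const (\<alpha> ij) * (x ^ fst ij * y ^ snd ij)) - z) \<epsilon>))"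
    using exists_hypercyclic_pair by (elim exE conjE) (rule that)
  note xy = xy_all[rule_format]
  define mon where "mon ij = fps_nth (x ^ fst ij * y ^ snd ij)" for ij :: "nat \<times> nat"
  have mon_X: "mon ij \<in> X" for ij
    unfolding mon_def
  proof (rule l1_le_in)
    fix q
    obtain b c where "l1_le q x b" "l1_le q y c" using x y by blast
    then obtain b' c' where "l1_le q (x ^ fst ij) b'" "l1_le q (y ^ snd ij) c'"
      using l1_le_power by blast
    then show "\<exists>c. l1_le q (x ^ fst ij * y ^ snd ij) c" using l1_le_mult by blast
  qed
  have mon_mult: "cauchy_prod (mon ij) (mon kl) = mon (fst ij + fst kl, snd ij + snd kl)" for ij kl
    unfolding mon_def cauchy_prod_fps by (simp add: power_add mult_ac)
  have subalg: "subalgebra_seq (seq.span (mon ` \<Gamma>))"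
    if "\<And>ij kl. ij \<in> \<Gamma> \<Longrightarrow> kl \<in> \<Gamma> \<Longrightarrow> (fst ij + fst kl, snd ij + snd kl) \<in> \<Gamma>" for \<Gamma>
    by (rule subalgebra_seq_span) (use that in \<open>auto simp: mon_mult\<close>)
  have in_HC: "(\<Sum>ij\<in>F. scale_seq (\<alpha> ij) (mon ij)) \<in> HC (seminorm_topology X p) (backward_shift w)"
    if F: "finite F" "(0, 0) \<notin> F" "\<exists>ij\<in>F. \<alpha> ij \<noteq> 0" for F \<alpha>
  proof -
    have "(\<Sum>ij\<in>F. scale_seq (\<alpha> ij) (mon ij)) \<in> X" by (intro X_sum X_scale mon_X)
    then show ?thesis
      unfolding mon_def fps_nth_sum_scale[symmetric] by (rule HC_I) (rule xy[OF F])
  qed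
  have indep: "(\<Sum>ij\<in>F. scale_seq (\<alpha> ij) (mon ij)) \<noteq> 0"
    if F: "finite F" "(0, 0) \<notin> F" "\<exists>ij\<in>F. \<alpha> ij \<noteq> 0" for F \<alpha>
  proof
    assume "(\<Sum>ij\<in>F. scale_seq (\<alpha> ij) (mon ij)) = 0"
    then have "fps_nth (\<Sum>ij\<in>F. fps_const (\<alpha> ij) * (x ^ fst ij * y ^ snd ij)) = 0"
      by (simp only: fps_nth_sum_scale mon_def)
    then have zero: "(\<Sum>ij\<in>F. fps_const (\<alpha> ij) * (x ^ fst ij * y ^ snd ij)) = 0"
      by (intro fps_ext) (simp only: zero_fun_apply fps_zero_nth)
    \<comment> \<open>If the combination were zero, all its shifts would be zero, and these stay at
      distance \<open>a q 0\<close> from the target \<open>1\<close>.\<close>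
    obtain q where q: "0 < a q 0" using a_pos by blast
    then have "0 < a q 0 / 2" by simp
    from xy[OF F this degree_le_1, of q] obtain N where "l1_le q (shift_pow N 0 - 1) (a q 0 / 2)"
      unfolding zero by blast
    then have "(\<Sum>n<1. cmod ((shift_pow N 0 - 1) $ n) * a q n) \<le> a q 0 / 2"
      unfolding l1_le_def by blast
    then show False using q by (simp add: shift_pow_zero)
  qed
  define \<Lambda> where "\<Lambda> = {ij :: nat \<times> nat. 1 \<le> fst ij}"
  \<comment> \<open>Closed under addition, since a sum of two exponents from
    \<open>\<Lambda>\<close> has first component at least 2, where the second is unrestricted. So
    its span is a subalgebra; it contains any given finite subset of \<open>A\<close> once
    \<open>J\<close> is large, but it misses \<open>x * y ^ Suc J\<close>.\<close>
  define \<Gamma> where "\<Gamma> J = {ij \<in> \<Lambda>. fst ij = 1 \<longrightarrow> snd ij \<le> J}" for J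
  define A where "A = seq.span (mon ` \<Lambda>)"
  have "A \<subseteq> X" unfolding A_def by (rule seq.span_minimal[OF _ subspace]) (use mon_X in blast)
  have A: "subalgebra_seq A" unfolding A_def by (rule subalg) (auto simp: \<Lambda>_def)
  have A_HC: "A - {0} \<subseteq> HC (seminorm_topology X p) (backward_shift w)"
  proof
    fix g assume g: "g \<in> A - {0}"
    then have "g \<in> seq.span (mon ` \<Lambda>)" by (simp add: A_def)
    from span_image_representation[OF this] obtain F \<alpha> where F: "finite F" "F \<subseteq> \<Lambda>" "g = (\<Sum>ij\<in>F. scale_seq (\<alpha> ij) (mon ij))"
      by (elim exE conjE) (rule that)
    have "\<exists>ij\<in>F. \<alpha> ij \<noteq> 0"
    proof (rule ccontr)
      assume "\<not> ?thesis"
      then have "g = (\<Sum>ij\<in>F. 0)" unfolding F(3) by (intro sum.cong refl) simp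
      then have "g = 0" by (simp only: sum.neutral_const)
      then show False using g by blast
    qed
    moreover have "(0, 0) \<notin> F" using F(2) by (auto simp: \<Lambda>_def)
    ultimately show "g \<in> HC (seminorm_topology X p) (backward_shift w)"
      unfolding F(3) by (intro in_HC F(1))
  qed
  have "\<not> finitely_generated_alg A"
  proof
    assume "finitely_generated_alg A"
    then obtain S where S: "finite S" "subalgebra_seq hull S = A"
      unfolding finitely_generated_alg_def by blast
    have "S \<subseteq> A" unfolding S(2)[symmetric] by (rule hull_subset)
    have "\<exists>J. S \<subseteq> seq.span (mon ` \<Gamma> J)"
      using S(1) \<open>S \<subseteq> A\<close>
    proof (induction S)
      case empty show ?case by simp
    next
      case (insert g S)
      then obtain J where J: "S \<subseteq> seq.span (mon ` \<Gamma> J)" by blast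
      have "g \<in> seq.span (mon ` \<Lambda>)" using insert.prems by (simp add: A_def)
      from span_image_representation[OF this] obtain F \<alpha> where F: "finite F" "F \<subseteq> \<Lambda>" "g = (\<Sum>ij\<in>F. scale_seq (\<alpha> ij) (mon ij))"
        by (elim exE conjE) (rule that)
      define K where "K = max J (Max (insert 0 (snd ` F)))"
      have "F \<subseteq> \<Gamma> K"
      proof
        fix ij assume ij: "ij \<in> F"
        have "snd ij \<le> Max (insert 0 (snd ` F))" by (rule Max_ge) (use F(1) ij in auto)
        then show "ij \<in> \<Gamma> K" using ij F(2) by (auto simp: \<Gamma>_def K_def)
      qed
      then have "g \<in> seq.span (mon ` \<Gamma> K)"
        unfolding F(3) by (intro seq.span_sum seq.span_scale seq.span_base) blast
      moreover have "seq.span (mon ` \<Gamma> J) \<subseteq> seq.span (mon ` \<Gamma> K)"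
        by (intro seq.span_mono image_mono) (auto simp: \<Gamma>_def K_def)
      ultimately show ?case using J by blast
    qed
    then obtain J where J: "S \<subseteq> seq.span (mon ` \<Gamma> J)" by blast
    have "subalgebra_seq (seq.span (mon ` \<Gamma> J))"
      by (rule subalg) (auto simp: \<Gamma>_def \<Lambda>_def)
    then have "A \<subseteq> seq.span (mon ` \<Gamma> J)" unfolding S(2)[symmetric] by (rule hull_minimal[OF J])
    moreover have "mon (1, Suc J) \<in> A"
      unfolding A_def by (intro seq.span_base imageI) (simp add: \<Lambda>_def)
    ultimately have "mon (1, Suc J) \<in> seq.span (mon ` \<Gamma> J)" by blast
    from span_image_representation[OF this] obtain F \<alpha> where F: "finite F" "F \<subseteq> \<Gamma> J" "mon (1, Suc J) = (\<Sum>ij\<in>F. scale_seq (\<alpha> ij) (mon ij))"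
      by (elim exE conjE) (rule that)
    have notin: "(1, Suc J) \<notin> F" using F(2) by (auto simp: \<Gamma>_def)
    \<comment> \<open>The coefficient \<open>-1\<close> moves \<open>x * y ^ Suc J\<close> to the
      other side, giving a nontrivial combination that vanishes.\<close>
    define \<beta> where "\<beta> = \<alpha>((1, Suc J) := -1)"
    have "(\<Sum>ij\<in>F. scale_seq (\<beta> ij) (mon ij)) = mon (1, Suc J)"
      unfolding F(3) by (rule sum.cong) (use notin in \<open>auto simp: \<beta>_def\<close>)
    then have "(\<Sum>ij\<in>insert (1, Suc J) F. scale_seq (\<beta> ij) (mon ij)) = scale_seq (-1) (mon (1, Suc J)) + mon (1, Suc J)"
      unfolding sum.insert[OF F(1) notin] by (simp only: \<beta>_def fun_upd_same)
    also have "\<dots> = 0" by (rule ext) (simp add: scale_seq_def)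
    finally have "(\<Sum>ij\<in>insert (1, Suc J) F. scale_seq (\<beta> ij) (mon ij)) = 0" .
    moreover have "(\<Sum>ij\<in>insert (1, Suc J) F. scale_seq (\<beta> ij) (mon ij)) \<noteq> 0"
      by (rule indep) (use F(1,2) in \<open>auto simp: \<beta>_def \<Gamma>_def \<Lambda>_def\<close>)
    ultimately show False by (rule notE[rotated])
  qed
  then show ?thesis using \<open>A \<subseteq> X\<close> A A_HC by (intro exI[of _ A] conjI)
qed

end

unbundle no fps_syntax and vec_syntax

theorem theorem3p6:
  fixes X :: "cseq set" and p :: "nat \<Rightarrow> cseq \<Rightarrow> real" and w :: cseq
  assumes "frechet_sequence_algebra X p"
    and "schauder_basis (seminorm_topology X p) unit_seq"
    and "property_B X p"
    and "weight_seq w"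
    and "backward_shift w ` X \<subseteq> X"
    and "mixing (seminorm_topology X p) (backward_shift w)"
  shows "(\<exists>A\<subseteq>X. subalgebra_seq A \<and> \<not> finitely_generated_alg A \<and>
            A - {0} \<subseteq> HC (seminorm_topology X p) (backward_shift w))
         \<and> algebrable_in X (HC (seminorm_topology X p) (backward_shift w))"
proof -
  interpret mixing_shift X p w
    by unfold_locales (rule assms)+
  obtain A where A: "A \<subseteq> X" "subalgebra_seq A" "\<not> finitely_generated_alg A"
    "A - {0} \<subseteq> HC (seminorm_topology X p) (backward_shift w)"
    using exists_hypercyclic_algebra by blast
  \<comment> \<open>\<open>A\<close> generates itself; were it finite, it would be finitely
    generated. So it is its own infinite generating set.\<close>
  have "subalgebra_seq hull A = A" by (rule hull_same[of subalgebra_seq, OF A(2)])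
  then have "infinite A" "infinitely_generated_alg A"
    using A(3) unfolding finitely_generated_alg_def infinitely_generated_alg_def by metis+
  then show ?thesis using A unfolding algebrable_in_def by blast
qed

end
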